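(* Assume that the sequence $\{a_n,b_n,c_n,d_n\}$, $n\in\mathbb{N}$, is uniformly bounded, i.e. there exists $K\in\mathbb{R}_+$ such that $\max\{|a_n(t)|,|b_n(t)|,|c_n(t)|,|d_n(t)|\}\le K$ for all $n\in\mathbb{N}$ and $t\in\mathbb{R}$. Then $\{a_n,b_n,c_n,d_n\}$, $n\in\mathbb{N}$, is a solution of $$\begin{cases}\dot a_n=c_n-c_{n-2}\\ \dot b_n=c_na_{n+1}-c_{n-1}a_n+d_n-d_{n-2}\\ \dot c_n=c_n(b_{n+1}-b_n)+d_na_{n+2}-d_{n-1}a_n\\ \dot d_n=d_n(b_{n+2}-b_n)\end{cases}\qquad n\in\mathbb{N},$$ if, and only if, the Weyl function satisfies $$\dot R_J(z)=R_J(z)(zI_{2\times2}-J_{11})-I_{2\times2}+[R_J(z),(J_-)_{11}]$$ for all $z\in\mathbb{C}$ such that $|z|>\|J\|$. Moreover, the Weyl function in this case is given by $$R_J(z)=e^{zt}\,M\,T(t,z)\,(N(t))^{-1},$$ where $$N(t)=\begin{bmatrix}e^{\int_0^tb_1\,ds}& e^{\int_0^tb_1\,ds}\int_0^ta_2\,e^{\int_0^s(b_2-b_1)\,dr}\,ds\\0&e^{\int_0^tb_2\,ds}\end{bmatrix},\qquad T(t,z)=-\int_0^te^{-zs}M^{-1}N(s)\,ds+M_0^{-1}R_0(z),$$ $M=M(t)=\begin{bmatrix}1&0\\-a_1(t)&1\end{bmatrix}$ (with $M^{-1}=M(s)^{-1}$ inside the integral), and $M_0$, $R_0(z)$ are,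 respectively, $M$ and $R_J(z)$ for $t=0$.
   Context: $\mathbb{N}=\{1,2,\dots\}$. The $a_n,b_n,c_n,d_n$ ($n\in\mathbb{N}$) are differentiable functions of $t\in\mathbb{R}$; a dot denotes $d/dt$, and the $t$-dependence is suppressed in the notation. Conventions: $a_1(t)\in\mathbb{R}$; $a_0=b_0=c_0=d_0=0$, $c_{-1}=d_{-1}=0$; and $d_n(t)\ne0$ for all $n\ge1$. $J=J(t)$ is the semi-infinite banded matrix (rows and columns indexed from $1$) with $(n,n)$ entry $b_n$, $(n,n+1)$ entry $a_{n+1}$, $(n,n+2)$ entry $1$, $(n+1,n)$ entry $c_n$, $(n+2,n)$ entry $d_n$ and zeros elsewhere, viewed as a bounded operator on $\ell^2$; $J_-$ is its strictly lower triangular part. $\|J\|$ is the operator norm, understood as $\sup_t\|J(t)\|$. For an infinite matrix $X$, $X_{11}$ denotes its upper-left $2\times2$ block, and $J^n_{11}$ is the upper-left $2\times2$ block of $J^n$; thus $J_{11}=\begin{bmatrix}b_1&a_2\\c_1&b_2\end{bmatrix}$ and $(J_-)_{11}=\begin{bmatrix}0&0\\c_1&0\end{bmatrix}$. The Weyl function is $R_J(z)=\sum_{n=0}^\infty\dfrac{J^n_{11}}{z^{n+1}}$, $|z|>\|J\|$. $[X,Y]=XY-YX$, and $I_{2\times 2}$ is the $2\times2$ identity matrix.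
   Formalization: Since a_1 does not occur in J, the Weyl equation cannot imply the equation \dot a_1 = c_1; so proved is: the system is equivalent to the Weyl equation together with \dot a_1 = c_1, and the system without \dot a_1 = c_1 is equivalent to the Weyl equation alone. *)

theory Defs
  imports "HOL-Analysis.Analysis"
begin

text \<open>
  Infinite matrices are functions of two indices in \<open>{1..}\<close>; values at index 0 are never used.
\<close>

type_synonym imat = "nat \<Rightarrow> nat \<Rightarrow> complex"

definition imat_mult :: "imat \<Rightarrow> imat \<Rightarrow> imat" where
  "imat_mult X Y = (\<lambda>i j. \<Sum>\<^sub>\<infinity>k\<in>{1..}. X i k * Y k j)"

primrec imat_pow :: "imat \<Rightarrow> nat \<Rightarrow> imat" where
  "imat_pow X 0 = (\<lambda>i j. if i = j then 1 else 0)"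
| "imat_pow X (Suc n) = imat_mult X (imat_pow X n)"

definition imat_apply :: "imat \<Rightarrow> (nat \<Rightarrow> complex) \<Rightarrow> nat \<Rightarrow> complex" where
  "imat_apply X x = (\<lambda>i. \<Sum>\<^sub>\<infinity>j\<in>{1..}. X i j * x j)"

definition strict_lower :: "imat \<Rightarrow> imat" where
  "strict_lower X = (\<lambda>i j. if j < i then X i j else 0)"

definition block11 :: "imat \<Rightarrow> complex^2^2" where
  "block11 X = vector [vector [X 1 1, X 1 2], vector [X 2 1, X 2 2]]"

definition ell2 :: "(nat \<Rightarrow> complex) set" where
  "ell2 = {x. (\<lambda>n. (cmod (x n))\<^sup>2) summable_on {1..}}"

definition ell2_norm :: "(nat \<Rightarrow> complex) \<Rightarrow> real" where
  "ell2_norm x = sqrt (\<Sum>\<^sub>\<infinity>n\<in>{1..}. (cmod (x n))\<^sup>2)"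

text \<open>
  The suprema below are suprema of real numbers, hence meaningful only if they are bounded above.
  For the matrices \<open>band_matrix a b c d t\<close> with coefficients bounded uniformly in \<open>n\<close> and \<open>t\<close>
  they are: such a matrix is a sum of five weighted shifts of uniformly bounded norm.
\<close>

definition imat_opnorm :: "imat \<Rightarrow> real" where
  "imat_opnorm X = (SUP x\<in>{x \<in> ell2. ell2_norm x \<le> 1}. ell2_norm (imat_apply X x))"

definition sup_opnorm :: "(real \<Rightarrow> imat) \<Rightarrow> real" where
  "sup_opnorm J = (SUP t. imat_opnorm (J t))"

text \<open>The coefficient \<open>a 1\<close> does not occur in the following matrix.\<close>

definition band_matrix ::
    "(nat \<Rightarrow> real \<Rightarrow> complex) \<Rightarrow> (nat \<Rightarrow> real \<Rightarrow> complex) \<Rightarrow>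
     (nat \<Rightarrow> real \<Rightarrow> complex) \<Rightarrow> (nat \<Rightarrow> real \<Rightarrow> complex) \<Rightarrow> real \<Rightarrow> imat" where
  "band_matrix a b c d t = (\<lambda>i j.
     if j = i then b i t
     else if j = i + 1 then a (i + 1) t
     else if j = i + 2 then 1
     else if i = j + 1 then c j t
     else if i = j + 2 then d j t
     else 0)"

definition cscale :: "complex \<Rightarrow> complex^2^2 \<Rightarrow> complex^2^2" where
  "cscale z A = (\<chi> i j. z * A $ i $ j)"

definition weyl :: "imat \<Rightarrow> complex \<Rightarrow> complex^2^2" where
  "weyl X z = (\<Sum>n. cscale (1 / z ^ (n + 1)) (block11 (imat_pow X n)))"

definition weyl_equation :: "(real \<Rightarrow> imat) \<Rightarrow> bool" where
  "weyl_equation J \<longleftrightarrow>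
     (\<forall>t z. cmod z > sup_opnorm J \<longrightarrow>
       ((\<lambda>s. weyl (J s) z) has_vector_derivative
          (weyl (J t) z ** (cscale z (mat 1) - block11 (J t)) - mat 1
           + (weyl (J t) z ** block11 (strict_lower (J t))
              - block11 (strict_lower (J t)) ** weyl (J t) z))) (at t))"

text \<open>
  Subtraction on \<^typ>\<open>nat\<close> is truncated: for \<open>n = 1\<close> the terms \<open>c (n - 2)\<close> and \<open>d (n - 2)\<close>
  stand for the coefficients with index -1, and they are evaluated at index 0. Under the
  convention that the coefficients with index -1 and 0 all vanish, this makes no difference.
\<close>

definition lattice_solution ::
    "(nat \<Rightarrow> real \<Rightarrow> complex) \<Rightarrow> (nat \<Rightarrow> real \<Rightarrow> complex) \<Rightarrow>
     (nat \<Rightarrow> real \<Rightarrow> complex) \<Rightarrow> (nat \<Rightarrow> real \<Rightarrow> complex) \<Rightarrow> bool" where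
  "lattice_solution a b c d \<longleftrightarrow>
     (\<forall>n\<ge>1. \<forall>t.
       (a n has_vector_derivative (c n t - c (n - 2) t)) (at t) \<and>
       (b n has_vector_derivative
          (c n t * a (n + 1) t - c (n - 1) t * a n t + d n t - d (n - 2) t)) (at t) \<and>
       (c n has_vector_derivative
          (c n t * (b (n + 1) t - b n t) + d n t * a (n + 2) t - d (n - 1) t * a n t)) (at t) \<and>
       (d n has_vector_derivative (d n t * (b (n + 2) t - b n t))) (at t))"

text \<open>
  The same system without its only equation that constrains \<open>a 1\<close>, namely that the derivative of
  \<open>a 1\<close> is \<open>c 1\<close>. (In the other equations \<open>a 1\<close> is multiplied by \<open>c 0\<close> or \<open>d 0\<close>.)
\<close>

definition lattice_solution_entries ::
    "(nat \<Rightarrow> real \<Rightarrow> complex) \<Rightarrow> (nat \<Rightarrow> real \<Rightarrow> complex) \<Rightarrow>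
     (nat \<Rightarrow> real \<Rightarrow> complex) \<Rightarrow> (nat \<Rightarrow> real \<Rightarrow> complex) \<Rightarrow> bool" where
  "lattice_solution_entries a b c d \<longleftrightarrow>
     (\<forall>n\<ge>1. \<forall>t.
       (n \<ge> 2 \<longrightarrow> (a n has_vector_derivative (c n t - c (n - 2) t)) (at t)) \<and>
       (b n has_vector_derivative
          (c n t * a (n + 1) t - c (n - 1) t * a n t + d n t - d (n - 2) t)) (at t) \<and>
       (c n has_vector_derivative
          (c n t * (b (n + 1) t - b n t) + d n t * a (n + 2) t - d (n - 1) t * a n t)) (at t) \<and>
       (d n has_vector_derivative (d n t * (b (n + 2) t - b n t))) (at t))"

definition M_mat :: "(nat \<Rightarrow> real \<Rightarrow> complex) \<Rightarrow> real \<Rightarrow> complex^2^2" where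
  "M_mat a t = vector [vector [1, 0], vector [- a 1 t, 1]]"

text \<open>The integrals from 0 to \<open>t\<close> are oriented, so that \<open>t < 0\<close> is covered.\<close>

definition N_mat ::
    "(nat \<Rightarrow> real \<Rightarrow> complex) \<Rightarrow> (nat \<Rightarrow> real \<Rightarrow> complex) \<Rightarrow> real \<Rightarrow> complex^2^2" where
  "N_mat a b t = vector
     [vector [exp (LBINT s=0..t. b 1 s),
              exp (LBINT s=0..t. b 1 s) *
                (LBINT s=0..t. a 2 s * exp (LBINT r=0..s. (b 2 r - b 1 r)))],
      vector [0, exp (LBINT s=0..t. b 2 s)]]"

definition T_mat ::
    "(nat \<Rightarrow> real \<Rightarrow> complex) \<Rightarrow> (nat \<Rightarrow> real \<Rightarrow> complex) \<Rightarrow> (real \<Rightarrow> imat) \<Rightarrow>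
     real \<Rightarrow> complex \<Rightarrow> complex^2^2" where
  "T_mat a b J t z =
     - (LBINT s=0..t. cscale (exp (- z * of_real s)) (matrix_inv (M_mat a s) ** N_mat a b s))
     + matrix_inv (M_mat a 0) ** weyl (J 0) z"

end

theory Submission
  imports Defs "HOL-Complex_Analysis.Cauchy_Integral_Formula"
begin

text \<open>
  Entrywise, the lattice equations say \<open>J' = [J, L]\<close> where \<open>L\<close> is the strictly lower part of \<open>J\<close>.
  Since \<open>J - L\<close> is upper and \<open>L\<close> strictly lower triangular, the upper left block of \<open>[J^n, L]\<close> depends
  only on the blocks of \<open>J^(n+1)\<close>, \<open>J^n\<close>, \<open>J\<close> and \<open>L\<close>, and the Weyl equation is the generating
  function of the moment equations \<open>(J^n)' = [J^n, L]\<close> on upper left blocks. Termwise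
  differentiation is justified by \<open>|J^n i j| \<le> \<parallel>J\<parallel>^n\<close>.

  Conversely, let \<open>E\<^sub>n = (J^n)' - [J^n, L]\<close>, so that \<open>E\<^sub>m\<^sub>+\<^sub>n = E\<^sub>m J^n + J^m E\<^sub>n\<close>, and suppose that all
  upper left blocks of \<open>E\<^sub>n\<close> vanish. The first two rows of the powers \<open>J^m\<close> form a unitriangular
  matrix and the first two columns of the powers \<open>J^n\<close> an invertible upper triangular matrix
  (here the outermost diagonals, \<open>1\<close> and \<open>d\<close>, must not vanish). Uniqueness of the infinitesimal LU
  decomposition shows that the first two rows of all \<open>E\<^sub>n\<close> vanish, and then so does \<open>E\<^sub>1\<close>.

  For the explicit formula, \<open>exp (- z t) M\<^sup>-\<^sup>1 R N\<close> has derivative \<open>- exp (- z t) M\<^sup>-\<^sup>1 N\<close>.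
\<close>

section \<open>Banded infinite matrices\<close>

text \<open>Finite band width turns every matrix product into a finite sum, so associativity,
  bilinearity and differentiation of products need no summability argument.\<close>

definition banded :: "nat \<Rightarrow> imat \<Rightarrow> bool" where
  "banded w X \<longleftrightarrow> (\<forall>i j. i + w < j \<or> j + w < i \<longrightarrow> X i j = 0)"

definition imat_comm :: "imat \<Rightarrow> imat \<Rightarrow> imat" where
  "imat_comm X Y = (\<lambda>i j. imat_mult X Y i j - imat_mult Y X i j)"

lemma bandedD: "banded w X \<Longrightarrow> i + w < j \<or> j + w < i \<Longrightarrow> X i j = 0"
  by (auto simp: banded_def)

lemma imat_mult_eq_sum:
  assumes "\<And>k. N < k \<Longrightarrow> X i k * Y k j = 0"
  shows "imat_mult X Y i j = (\<Sum>k=1..N. X i k * Y k j)"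
proof -
  have "imat_mult X Y i j = (\<Sum>\<^sub>\<infinity>k\<in>{1..N}. X i k * Y k j)"
    unfolding imat_mult_def
    by (rule infsum_cong_neutral) (use assms in \<open>auto simp: not_le\<close>)
  then show ?thesis by simp
qed

lemma imat_mult_banded:
  assumes "banded w X" "i + w \<le> N"
  shows "imat_mult X Y i j = (\<Sum>k=1..N. X i k * Y k j)"
  by (rule imat_mult_eq_sum) (use assms in \<open>auto simp: bandedD\<close>)

lemma banded_imat_mult:
  assumes X: "banded w X" and Y: "banded w' Y"
  shows "banded (w + w') (imat_mult X Y)"
  unfolding banded_def
proof (intro allI impI)
  fix i j assume ij: "i + (w + w') < j \<or> j + (w + w') < i"
  have "X i k * Y k j = 0" for k
  proof (cases "i + w < k \<or> k + w < i")
    case True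
    then show ?thesis using X by (simp add: bandedD)
  next
    case False
    then have "k + w' < j \<or> j + w' < k" using ij by auto
    then show ?thesis using Y by (simp add: bandedD)
  qed
  \<comment> \<open>All terms vanish, so the bound 0 is admissible; the finite sum then runs over
    the empty range \<open>{1..0}\<close>.\<close>
  then show "imat_mult X Y i j = 0"
    by (subst imat_mult_eq_sum[of 0]) auto
qed

lemma banded_imat_comm:
  assumes "banded w X" "banded w' Y"
  shows "banded (w + w') (imat_comm X Y)"
  using banded_imat_mult[OF assms] banded_imat_mult[OF assms(2,1)]
  by (auto simp: banded_def imat_comm_def)

lemma banded_imat_pow:
  assumes "banded w X"
  shows "banded (n * w) (imat_pow X n)"
proof (induction n)
  case (Suc n)
  then show ?case using banded_imat_mult[OF assms] by simp
qed (auto simp: banded_def)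

lemma imat_mult_assoc:
  assumes X: "banded w X" and Y: "banded w' Y"
  shows "imat_mult (imat_mult X Y) Z = imat_mult X (imat_mult Y Z)"
proof (intro ext)
  fix i j
  \<comment> \<open>\<open>N\<close> bounds the support of row \<open>i\<close> of
    \<open>imat_mult X Y\<close> and of every row \<open>l \<le> i + w\<close> of \<open>Y\<close>,
    so the double sum has a rectangular range and can be swapped.\<close>
  define N where "N = i + w + w'"
  have "imat_mult (imat_mult X Y) Z i j = (\<Sum>k=1..N. imat_mult X Y i k * Z k j)"
    by (rule imat_mult_banded[OF banded_imat_mult[OF X Y]]) (simp add: N_def)
  also have "\<dots> = (\<Sum>k=1..N. (\<Sum>l=1..i+w. X i l * Y l k) * Z k j)"
    by (simp add: imat_mult_banded[OF X order.refl])
  also have "\<dots> = (\<Sum>k=1..N. \<Sum>l=1..i+w. X i l * (Y l k * Z k j))"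
    by (simp add: sum_distrib_right mult.assoc)
  also have "\<dots> = (\<Sum>l=1..i+w. \<Sum>k=1..N. X i l * (Y l k * Z k j))"
    by (rule sum.swap)
  also have "\<dots> = (\<Sum>l=1..i+w. X i l * imat_mult Y Z l j)"
    by (rule sum.cong[OF refl])
      (simp add: imat_mult_banded[OF Y, where N = N] N_def sum_distrib_left)
  also have "\<dots> = imat_mult X (imat_mult Y Z) i j"
    by (simp add: imat_mult_banded[OF X order.refl])
  finally show "imat_mult (imat_mult X Y) Z i j = imat_mult X (imat_mult Y Z) i j" .
qed

lemma imat_mult_diff_left:
  assumes "banded w X" "banded w' Y"
  shows "imat_mult (\<lambda>i j. X i j - Y i j) Z i j = imat_mult X Z i j - imat_mult Y Z i j"
proof -
  have "banded (w + w') (\<lambda>i j. X i j - Y i j)"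
    using assms by (auto simp: banded_def)
  then have "imat_mult (\<lambda>i j. X i j - Y i j) Z i j = (\<Sum>k=1..i+w+w'. (X i k - Y i k) * Z k j)"
    by (rule imat_mult_banded) simp
  also have "\<dots> = imat_mult X Z i j - imat_mult Y Z i j"
    using assms by (simp add: imat_mult_banded[where N = "i+w+w'"] left_diff_distrib sum_subtractf)
  finally show ?thesis .
qed

lemma imat_mult_diff_right:
  assumes "banded w X"
  shows "imat_mult X (\<lambda>i j. Y i j - Z i j) i j = imat_mult X Y i j - imat_mult X Z i j"
  using assms by (simp add: imat_mult_banded[OF assms order.refl] right_diff_distrib sum_subtractf)

text \<open>The commutator with \<open>L\<close> is a derivation: the two terms \<open>X L Y\<close>
  cancel after reassociation.\<close>

lemma imat_comm_mult:
  assumes X: "banded w X" and Y: "banded w' Y" and L: "banded v L"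
  shows "imat_comm (imat_mult X Y) L i j =
    imat_mult (imat_comm X L) Y i j + imat_mult X (imat_comm Y L) i j"
proof -
  have "imat_mult (imat_comm X L) Y i j =
      imat_mult (imat_mult X L) Y i j - imat_mult (imat_mult L X) Y i j"
    unfolding imat_comm_def
    by (rule imat_mult_diff_left[OF banded_imat_mult[OF X L] banded_imat_mult[OF L X]])
  moreover have "imat_mult X (imat_comm Y L) i j =
      imat_mult X (imat_mult Y L) i j - imat_mult X (imat_mult L Y) i j"
    unfolding imat_comm_def by (rule imat_mult_diff_right[OF X])
  ultimately show ?thesis
    by (simp add: imat_comm_def[of "imat_mult X Y"] imat_mult_assoc[OF X Y] imat_mult_assoc[OF X L]
        imat_mult_assoc[OF L X])
qed

text \<open>Products sum over indices from 1, so the Kronecker delta is a unit only there; hence the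
  conditions \<open>1 \<le> i\<close> and \<open>1 \<le> j\<close> further on.\<close>

lemma imat_mult_one_left:
  "1 \<le> i \<Longrightarrow> imat_mult (\<lambda>i j. if i = j then 1 else 0) X i j = X i j"
  by (subst imat_mult_eq_sum[of i]) (auto simp: if_distrib[of "\<lambda>x. x * _"] cong: if_cong)

lemma imat_mult_one_right:
  "1 \<le> j \<Longrightarrow> imat_mult X (\<lambda>i j. if i = j then 1 else 0) i j = X i j"
  by (subst imat_mult_eq_sum[of j]) (auto simp: if_distrib[of "\<lambda>x. _ * x"] cong: if_cong)

lemma imat_pow_1: "1 \<le> j \<Longrightarrow> imat_pow X 1 i j = X i j"
  by (simp add: imat_mult_one_right)

lemma imat_mult_cong_row:
  "(\<And>k. 1 \<le> k \<Longrightarrow> X i k = X' i k) \<Longrightarrow> (\<And>k. 1 \<le> k \<Longrightarrow> Y k j = Y' k j) \<Longrightarrow>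
    imat_mult X Y i j = imat_mult X' Y' i j"
  unfolding imat_mult_def by (rule infsum_cong) simp

lemma imat_pow_add:
  assumes "banded w X" "1 \<le> i"
  shows "imat_pow X (m + n) i j = imat_mult (imat_pow X m) (imat_pow X n) i j"
  using assms(2)
proof (induction m arbitrary: i)
  case 0
  then show ?case by (simp add: imat_mult_one_left)
next
  case (Suc m)
  have "imat_pow X (Suc m + n) i j = imat_mult X (imat_mult (imat_pow X m) (imat_pow X n)) i j"
    by (simp, intro imat_mult_cong_row) (use Suc.IH in auto)
  also have "\<dots> = imat_mult (imat_pow X (Suc m)) (imat_pow X n) i j"
    by (simp add: imat_mult_assoc[OF assms(1) banded_imat_pow[OF assms(1)]])
  finally show ?case .
qed

text \<open>Powers are built by multiplication from the left; commutators also need the last factor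
  on the right.\<close>

lemma imat_pow_Suc_right:
  assumes "banded w X" "1 \<le> i" "1 \<le> j"
  shows "imat_pow X (Suc n) i j = imat_mult (imat_pow X n) X i j"
proof -
  have "imat_pow X (Suc n) i j = imat_mult (imat_pow X n) (imat_pow X 1) i j"
    using imat_pow_add[OF assms(1,2), of n 1] by simp
  also have "\<dots> = imat_mult (imat_pow X n) X i j"
    using assms(3) by (intro imat_mult_cong_row) (auto simp only: imat_pow_1)
  finally show ?thesis .
qed

text \<open>A width independent of \<open>s\<close> gives a finite sum with fixed range, to which
  the scalar product rule applies termwise.\<close>

lemma has_vector_derivative_imat_mult:
  assumes X: "\<And>s. banded w (X s)" and X': "banded w X'"
    and dX: "\<And>k. 1 \<le> k \<Longrightarrow> ((\<lambda>s. X s i k) has_vector_derivative X' i k) (at t)"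
    and dY: "\<And>k. 1 \<le> k \<Longrightarrow> ((\<lambda>s. Y s k j) has_vector_derivative Y' k j) (at t)"
  shows "((\<lambda>s. imat_mult (X s) (Y s) i j) has_vector_derivative
    imat_mult X' (Y t) i j + imat_mult (X t) Y' i j) (at t)"
proof -
  have "((\<lambda>s. \<Sum>k=1..i+w. X s i k * Y s k j) has_vector_derivative
      (\<Sum>k=1..i+w. X t i k * Y' k j + X' i k * Y t k j)) (at t)"
    by (intro has_vector_derivative_sum has_vector_derivative_mult dX dY) auto
  then show ?thesis
    by (simp add: imat_mult_banded[OF X order.refl] imat_mult_banded[OF X' order.refl]
        sum.distrib add.commute)
qed

text \<open>
  Infinitesimal uniqueness of the LU decomposition: if \<open>U' V + U V' = 0\<close> with \<open>U'\<close> strictly lower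
  and \<open>V'\<close> upper triangular, then \<open>U\<^sup>-\<^sup>1 U' = - V' V\<^sup>-\<^sup>1\<close> is both, hence zero.
\<close>

lemma triangular_product_eq_0:
  fixes u v u' v' :: "nat \<Rightarrow> nat \<Rightarrow> 'a::idom"
  assumes u: "\<And>p. 1 \<le> p \<Longrightarrow> u p p \<noteq> 0" "\<And>p j. 1 \<le> p \<Longrightarrow> p < j \<Longrightarrow> u p j = 0"
    and v: "\<And>q. 1 \<le> q \<Longrightarrow> v q q \<noteq> 0" "\<And>q j. 1 \<le> q \<Longrightarrow> q < j \<Longrightarrow> v j q = 0"
    and u': "\<And>p j. 1 \<le> p \<Longrightarrow> p \<le> j \<Longrightarrow> u' p j = 0"
    and v': "\<And>q j. 1 \<le> q \<Longrightarrow> q < j \<Longrightarrow> v' j q = 0"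
    and eq: "\<And>p q. 1 \<le> p \<Longrightarrow> 1 \<le> q \<Longrightarrow>
      (\<Sum>j=1..p+q. u' p j * v j q) + (\<Sum>j=1..p+q. u p j * v' j q) = 0"
    and "1 \<le> p" "1 \<le> q"
  shows "u' p q = 0"
proof -
  \<comment> \<open>Column \<open>m\<close> of \<open>u'\<close> and row \<open>m\<close> of
    \<open>v'\<close> vanish together, by strong induction on \<open>m\<close>: first the row, then
    the column.\<close>
  have "\<forall>p\<ge>1. u' p m = 0 \<and> v' m p = 0" if "1 \<le> m" for m
    using that
  proof (induction m rule: less_induct)
    case (less m)
    \<comment> \<open>In equation \<open>(m, q)\<close> the first sum vanishes by induction and
      triangularity of \<open>u'\<close>; the second reduces to
      \<open>u m m * v' m q\<close>.\<close>
    have row: "v' m q = 0" if "1 \<le> q" for q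
    proof -
      have "u' m j * v j q = 0" if "j \<in> {1..m+q}" for j
        using less u'[of m j] that by (cases "j < m") auto
      then have 1: "(\<Sum>j=1..m+q. u' m j * v j q) = 0" by (rule sum.neutral[rule_format])
      have "(\<Sum>j=1..m+q. u m j * v' j q) = (\<Sum>j\<in>{m}. u m j * v' j q)"
      proof (rule sum.mono_neutral_right)
        show "\<forall>j\<in>{1..m+q} - {m}. u m j * v' j q = 0"
          using less \<open>1 \<le> q\<close> u(2)[of m] by (auto simp: neq_iff)
      qed (use less in auto)
      with 1 eq[OF less.prems \<open>1 \<le> q\<close>] u(1)[OF less.prems] show ?thesis by simp
    qed
    \<comment> \<open>In equation \<open>(p, m)\<close> the row just found kills the second sum; the
      first reduces to \<open>u' p m * v m m\<close>.\<close>
    have col: "u' p m = 0" if "1 \<le> p" for p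
    proof -
      have "u p j * v' j m = 0" if "j \<in> {1..p+m}" for j
        using less row[of m] v'[of m j] that \<open>1 \<le> p\<close> by (cases "j < m"; cases "j = m") auto
      then have 1: "(\<Sum>j=1..p+m. u p j * v' j m) = 0" by (rule sum.neutral[rule_format])
      have "(\<Sum>j=1..p+m. u' p j * v j m) = (\<Sum>j\<in>{m}. u' p j * v j m)"
      proof (rule sum.mono_neutral_right)
        show "\<forall>j\<in>{1..p+m} - {m}. u' p j * v j m = 0"
          using less \<open>1 \<le> p\<close> v(2)[of m] by (auto simp: neq_iff)
      qed (use less in auto)
      with 1 eq[OF \<open>1 \<le> p\<close> less.prems] v(1)[OF less.prems] show ?thesis by simp
    qed
    show ?case using row col by simp
  qed
  then show ?thesis using assms by blast
qed

section \<open>Bounds on the powers of a banded matrix\<close>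

lemma nonneg_summable_on_sum_bound:
  fixes f :: "nat \<Rightarrow> real"
  assumes "\<And>n. 0 \<le> f n" "\<And>n. (\<Sum>i=1..n. f i) \<le> B"
  shows "f summable_on {1..}" "infsum f {1..} \<le> B"
proof -
  have fin: "sum f F \<le> B" if "finite F" "F \<subseteq> {1..}" for F
  proof -
    \<comment> \<open>A finite subset of \<open>{1..}\<close> lies in an initial segment; inserting
      0 keeps \<open>Max\<close> defined for empty \<open>F\<close>.\<close>
    have "sum f F \<le> sum f {1..Max (insert 0 F)}"
      using that assms(1) by (intro sum_mono2) (auto simp: Max_ge_iff)
    then show ?thesis using assms(2) order.trans by blast
  qed
  show "f summable_on {1..}"
    by (rule nonneg_bdd_above_summable_on) (use assms(1) fin in \<open>auto intro!: bdd_aboveI\<close>)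
  then show "infsum f {1..} \<le> B"
    by (rule infsum_le_finite_sums) (use fin in auto)
qed

lemma ell2_norm_nonneg: "0 \<le> ell2_norm x"
  by (simp add: ell2_norm_def infsum_nonneg)

lemma ell2_norm_power2: "(ell2_norm x)\<^sup>2 = (\<Sum>\<^sub>\<infinity>n\<in>{1..}. (cmod (x n))\<^sup>2)"
  by (simp add: ell2_norm_def infsum_nonneg)

lemma sum_le_ell2_norm:
  assumes "x \<in> ell2" "finite F" "F \<subseteq> {1..}"
  shows "(\<Sum>n\<in>F. (cmod (x n))\<^sup>2) \<le> (ell2_norm x)\<^sup>2"
  unfolding ell2_norm_power2
  by (rule finite_sum_le_infsum) (use assms in \<open>auto simp: ell2_def\<close>)

lemma cmod_le_ell2_norm:
  assumes "x \<in> ell2" "1 \<le> n"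
  shows "cmod (x n) \<le> ell2_norm x"
  by (rule power2_le_imp_le) (use sum_le_ell2_norm[of x "{n}"] assms ell2_norm_nonneg in auto)

lemma ell2_unit:
  assumes "1 \<le> j"
  shows "(\<lambda>i. if i = j then 1 else 0) \<in> ell2" "ell2_norm (\<lambda>i. if i = j then 1 else 0) = 1"
proof -
  have *: "((\<lambda>n. (cmod (if n = j then 1 else 0))\<^sup>2) has_sum 1) {1..}"
    by (rule has_sum_finite_neutralI[of "{j}"]) (use assms in auto)
  show "(\<lambda>i. if i = j then 1 else 0) \<in> ell2"
    using * unfolding ell2_def by (auto simp: summable_on_def)
  show "ell2_norm (\<lambda>i. if i = j then 1 else 0) = 1"
    using infsumI[OF *] by (simp add: ell2_norm_def)
qed

text \<open>Schur-type estimate: rows and columns have at most \<open>2 * w + 1\<close> nonzero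
  entries. Cauchy-Schwarz in each row costs this factor once, interchanging the sums costs it again,
  and the square root leaves it once.\<close>

lemma imat_apply_banded_bound:
  assumes X: "banded w X" and B: "\<And>i j. 1 \<le> i \<Longrightarrow> 1 \<le> j \<Longrightarrow> cmod (X i j) \<le> B" and x: "x \<in> ell2"
  shows "imat_apply X x \<in> ell2" "ell2_norm (imat_apply X x) \<le> (2 * real w + 1) * B * ell2_norm x"
proof -
  have B0: "0 \<le> B" using B[of 1 1] norm_ge_zero order.trans by blast
  define W where "W = 2 * real w + 1"
  define S where "S i = {k\<in>{1..}. i \<le> k + w \<and> k \<le> i + w}" for i
  have finS: "finite (S i)" for i
    by (rule finite_subset[of _ "{..i+w}"]) (auto simp: S_def)
  have cardS: "real (card (S i)) \<le> W" for i
  proof -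
    have "S i \<subseteq> {i-w..i+w}" by (auto simp: S_def)
    then have "card (S i) \<le> card {i-w..i+w}" by (intro card_mono) auto
    also have "\<dots> \<le> 2 * w + 1" by simp
    finally show ?thesis by (simp add: W_def)
  qed
  have app: "imat_apply X x i = (\<Sum>k\<in>S i. X i k * x k)" for i
  proof -
    have "imat_apply X x i = (\<Sum>\<^sub>\<infinity>k\<in>S i. X i k * x k)"
      unfolding imat_apply_def
      by (rule infsum_cong_neutral) (auto simp: S_def intro: bandedD[OF X])
    then show ?thesis using finS by simp
  qed
  have pt: "(cmod (imat_apply X x i))\<^sup>2 \<le> B\<^sup>2 * W * (\<Sum>k\<in>S i. (cmod (x k))\<^sup>2)" if "1 \<le> i" for i
  proof -
    have "cmod (imat_apply X x i) \<le> (\<Sum>k\<in>S i. B * cmod (x k))"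
      unfolding app using that
      by (intro sum_norm_le) (auto simp: norm_mult S_def intro!: mult_right_mono B)
    then have "(cmod (imat_apply X x i))\<^sup>2 \<le> (\<Sum>k\<in>S i. B * cmod (x k))\<^sup>2"
      by (intro power_mono) auto
    also have "\<dots> = B\<^sup>2 * (\<Sum>k\<in>S i. 1 * cmod (x k))\<^sup>2"
      by (simp add: sum_distrib_left[symmetric] power_mult_distrib)
    also have "\<dots> \<le> B\<^sup>2 * ((\<Sum>k\<in>S i. 1\<^sup>2) * (\<Sum>k\<in>S i. (cmod (x k))\<^sup>2))"
      by (intro mult_left_mono Cauchy_Schwarz_ineq_sum) auto
    also have "\<dots> \<le> B\<^sup>2 * (W * (\<Sum>k\<in>S i. (cmod (x k))\<^sup>2))"
      using cardS by (intro mult_left_mono mult_right_mono sum_nonneg) auto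
    finally show ?thesis by (simp add: mult.assoc)
  qed
  have part: "(\<Sum>i=1..n. (cmod (imat_apply X x i))\<^sup>2) \<le> (W * B * ell2_norm x)\<^sup>2" for n
  proof -
    have "(\<Sum>i=1..n. (cmod (imat_apply X x i))\<^sup>2) \<le>
        (\<Sum>i=1..n. B\<^sup>2 * W * (\<Sum>k\<in>S i. (cmod (x k))\<^sup>2))"
      by (intro sum_mono pt) auto
    also have "\<dots> = B\<^sup>2 * W * (\<Sum>i=1..n. \<Sum>k\<in>S i. (cmod (x k))\<^sup>2)"
      by (simp add: sum_distrib_left)
    \<comment> \<open>For positive indices \<open>k \<in> S i\<close> is symmetric in
      \<open>i\<close> and \<open>k\<close>, so after the swap the number of rows that see
      \<open>x k\<close> is again at most the size of a window.\<close>
    also have "(\<Sum>i=1..n. \<Sum>k\<in>S i. (cmod (x k))\<^sup>2) =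
        (\<Sum>i=1..n. \<Sum>k | k \<in> {1..n+w} \<and> i \<in> S k. (cmod (x k))\<^sup>2)"
      by (intro sum.cong) (auto simp: S_def)
    also have "\<dots> = (\<Sum>k=1..n+w. \<Sum>i | i \<in> {1..n} \<and> i \<in> S k. (cmod (x k))\<^sup>2)"
      by (rule sum.swap_restrict) auto
    also have "\<dots> \<le> (\<Sum>k=1..n+w. W * (cmod (x k))\<^sup>2)"
    proof (rule sum_mono)
      fix k
      have "card {i. i \<in> {1..n} \<and> i \<in> S k} \<le> card (S k)"
        using finS by (intro card_mono) auto
      then have "real (card {i. i \<in> {1..n} \<and> i \<in> S k}) \<le> W"
        using cardS[of k] by linarith
      then show "(\<Sum>i | i \<in> {1..n} \<and> i \<in> S k. (cmod (x k))\<^sup>2) \<le> W * (cmod (x k))\<^sup>2"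
        by (simp add: mult_right_mono)
    qed
    also have "\<dots> \<le> W * (ell2_norm x)\<^sup>2"
      unfolding sum_distrib_left[symmetric]
      by (intro mult_left_mono sum_le_ell2_norm x) (auto simp: W_def)
    finally have "(\<Sum>i=1..n. (cmod (imat_apply X x i))\<^sup>2) \<le> B\<^sup>2 * W * (W * (ell2_norm x)\<^sup>2)"
      by (auto simp: W_def mult_left_mono)
    then show ?thesis
      by (simp only: power_mult_distrib power2_eq_square mult_ac)
  qed
  show "imat_apply X x \<in> ell2"
    unfolding ell2_def using nonneg_summable_on_sum_bound(1)[OF _ part] by simp
  have "(ell2_norm (imat_apply X x))\<^sup>2 \<le> (W * B * ell2_norm x)\<^sup>2"
    unfolding ell2_norm_power2[of "imat_apply X x"]
    by (rule nonneg_summable_on_sum_bound(2)[OF _ part]) simp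
  then show "ell2_norm (imat_apply X x) \<le> (2 * real w + 1) * B * ell2_norm x"
    unfolding W_def[symmetric]
    by (rule power2_le_imp_le) (simp add: B0 ell2_norm_nonneg W_def)
qed

lemma ell2_scale:
  assumes "x \<in> ell2"
  shows "(\<lambda>n. k * x n) \<in> ell2"
proof -
  have "(\<lambda>n. (cmod k)\<^sup>2 * (cmod (x n))\<^sup>2) summable_on {1..}"
    by (rule summable_on_cmult_right) (use assms in \<open>simp only: ell2_def mem_Collect_eq\<close>)
  then show ?thesis by (simp only: ell2_def mem_Collect_eq norm_mult power_mult_distrib)
qed

lemma ell2_norm_scale: "ell2_norm (\<lambda>n. k * x n) = cmod k * ell2_norm x"
  by (simp add: ell2_norm_def norm_mult power_mult_distrib infsum_cmult_right' real_sqrt_mult)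


text \<open>The bound \<open>B\<close> keeps both suprema bounded above, hence genuine upper bounds;
  scaling \<open>x\<close> to norm 1 then gives the inequality. For norm 0 the crude bound already
  forces the value 0.\<close>

lemma ell2_norm_imat_apply_le_sup:
  assumes J: "\<And>t. banded w (J t)"
    and B: "\<And>t i j. 1 \<le> i \<Longrightarrow> 1 \<le> j \<Longrightarrow> cmod (J t i j) \<le> B"
    and x: "x \<in> ell2"
  shows "ell2_norm (imat_apply (J t) x) \<le> sup_opnorm J * ell2_norm x"
proof -
  define W where "W = (2 * real w + 1) * B"
  have bd: "ell2_norm (imat_apply (J s) y) \<le> W * ell2_norm y" if "y \<in> ell2" for s y
    unfolding W_def by (rule imat_apply_banded_bound(2)[OF J B that])
  have B0: "0 \<le> B" using B[of 1 1] norm_ge_zero order.trans by blast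
  have 1: "ell2_norm (imat_apply (J s) y) \<le> W" if "y \<in> ell2" "ell2_norm y \<le> 1" for s y
    using order.trans[OF bd[of y s] mult_left_mono[of "ell2_norm y" 1 W]] that B0
    by (simp add: W_def)
  have bdd: "bdd_above ((\<lambda>x. ell2_norm (imat_apply (J s) x)) ` {x \<in> ell2. ell2_norm x \<le> 1})" for s
    by (rule bdd_aboveI2[of _ _ W]) (simp add: 1)
  have ne: "{x \<in> ell2. ell2_norm x \<le> 1} \<noteq> {}"
    using ell2_unit[of 1] by fastforce
  have "bdd_above (range (\<lambda>s. imat_opnorm (J s)))"
    unfolding imat_opnorm_def by (intro bdd_aboveI2[of _ _ W] cSUP_least ne) (simp add: 1)
  then have sup: "imat_opnorm (J t) \<le> sup_opnorm J"
    unfolding sup_opnorm_def by (intro cSUP_upper) auto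
  show ?thesis
  proof (cases "ell2_norm x = 0")
    case True
    then show ?thesis using bd[OF x, of t] by simp
  next
    case False
    then have pos: "0 < ell2_norm x" using ell2_norm_nonneg[of x] by simp
    define k where "k = complex_of_real (1 / ell2_norm x)"
    have k: "cmod k * ell2_norm x = 1" using pos by (simp add: k_def norm_divide)
    have app: "imat_apply (J t) (\<lambda>n. k * x n) = (\<lambda>i. k * imat_apply (J t) x i)"
      unfolding imat_apply_def mult.left_commute[of _ k] by (subst infsum_cmult_right') (rule refl)
    have "ell2_norm (imat_apply (J t) (\<lambda>n. k * x n)) \<le> imat_opnorm (J t)"
      unfolding imat_opnorm_def
      by (rule cSUP_upper[OF _ bdd]) (simp add: ell2_scale ell2_norm_scale x k)
    with sup have "ell2_norm (imat_apply (J t) x) / ell2_norm x \<le> sup_opnorm J"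
      unfolding app ell2_norm_scale using pos by (simp add: k_def norm_divide)
    then show ?thesis using pos by (simp add: pos_divide_le_eq)
  qed
qed

text \<open>Column \<open>j\<close> of the power is \<open>J t\<close> applied \<open>n\<close>
  times to a unit vector, and an entry is at most the norm of its column. The operator norm in place
  of \<open>B\<close> gives convergence of the Weyl series on the whole region
  \<open>sup_opnorm J < cmod z\<close>.\<close>

lemma cmod_imat_pow_le:
  assumes J: "\<And>t. banded w (J t)"
    and B: "\<And>t i j. 1 \<le> i \<Longrightarrow> 1 \<le> j \<Longrightarrow> cmod (J t i j) \<le> B"
    and "1 \<le> i" "1 \<le> j"
  shows "0 \<le> sup_opnorm J" "cmod (imat_pow (J t) n i j) \<le> sup_opnorm J ^ n"
proof -
  define e where "e = (\<lambda>i. if i = j then 1 else 0 :: complex)"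
  have e: "e \<in> ell2" "ell2_norm e = 1"
    using ell2_unit[OF assms(4)] by (simp_all add: e_def)
  show S: "0 \<le> sup_opnorm J"
    using order.trans[OF ell2_norm_nonneg ell2_norm_imat_apply_le_sup[OF J B e(1)]] e(2) by simp
  have "(\<lambda>i. imat_pow (J t) n i j) \<in> ell2 \<and> ell2_norm (\<lambda>i. imat_pow (J t) n i j) \<le> sup_opnorm J ^ n"
  proof (induction n)
    case 0
    then show ?case using e by (simp add: e_def)
  next
    case (Suc n)
    have eq: "(\<lambda>i. imat_pow (J t) (Suc n) i j) = imat_apply (J t) (\<lambda>i. imat_pow (J t) n i j)"
      by (simp add: imat_mult_def imat_apply_def)
    let ?x = "\<lambda>i. imat_pow (J t) n i j"
    have "ell2_norm (imat_apply (J t) ?x) \<le> sup_opnorm J * ell2_norm ?x"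
      by (rule ell2_norm_imat_apply_le_sup[OF J B]) (use Suc in auto)
    also have "\<dots> \<le> sup_opnorm J ^ Suc n"
      using Suc S by (auto intro: mult_left_mono)
    finally have "ell2_norm (imat_apply (J t) ?x) \<le> sup_opnorm J ^ Suc n" .
    moreover have "imat_apply (J t) ?x \<in> ell2"
      by (rule imat_apply_banded_bound(1)[OF J B]) (use Suc in auto)
    ultimately show ?case unfolding eq by simp
  qed
  then show "cmod (imat_pow (J t) n i j) \<le> sup_opnorm J ^ n"
    using cmod_le_ell2_norm[OF _ assms(3)] by (meson order.trans)
qed

section \<open>Moments and the Lax equation\<close>

lemma banded_strict_lower: "banded w X \<Longrightarrow> banded w (strict_lower X)"
  by (auto simp: banded_def strict_lower_def)

lemma imat_mult_strict_lower_left: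
  assumes "1 \<le> i"
  shows "imat_mult (strict_lower X) P i j = (\<Sum>k=1..i-1. X i k * P k j)"
  by (subst imat_mult_eq_sum[of "i-1"]) (use assms in \<open>auto simp: strict_lower_def intro!: sum.cong\<close>)

text \<open>The difference of \<open>X\<close> and \<open>strict_lower X\<close> is upper
  triangular, so its column \<open>j\<close> reaches only \<open>k \<le> j\<close>.\<close>

lemma imat_mult_strict_lower_right:
  assumes P: "banded w P"
  shows "imat_mult P (strict_lower X) i j = imat_mult P X i j - (\<Sum>k=1..j. P i k * X k j)"
proof -
  define N where "N = i + w + j"
  have "imat_mult P X i j = (\<Sum>k=1..N. P i k * X k j)"
    by (rule imat_mult_banded[OF P]) (simp add: N_def)
  also have "\<dots> = (\<Sum>k=1..N. P i k * strict_lower X k j + (if k \<le> j then P i k * X k j else 0))"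
    by (intro sum.cong) (auto simp: strict_lower_def)
  also have "\<dots> = imat_mult P (strict_lower X) i j + (\<Sum>k=1..N. if k \<le> j then P i k * X k j else 0)"
    unfolding sum.distrib by (subst imat_mult_banded[OF P, of i N]) (auto simp: N_def)
  also have "(\<Sum>k=1..N. if k \<le> j then P i k * X k j else 0) = (\<Sum>k=1..j. P i k * X k j)"
    by (rule sum.mono_neutral_cong_right) (auto simp: N_def)
  finally show ?thesis by simp
qed

lemma block11_nth [simp]:
  "block11 X $ 1 $ 1 = X 1 1" "block11 X $ 1 $ 2 = X 1 2"
  "block11 X $ 2 $ 1 = X 2 1" "block11 X $ 2 $ 2 = X 2 2"
  by (simp_all add: block11_def)

text \<open>For indices 1 and 2 the truncated sums stay inside the blocks. The result is the
  coefficient of \<open>1 / z ^ (n + 1)\<close> on the right of the Weyl equation.\<close>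

lemma block11_imat_comm_pow:
  assumes X: "banded w X"
  shows "block11 (imat_comm (imat_pow X n) (strict_lower X)) =
    block11 (imat_pow X (Suc n)) - block11 (imat_pow X n) ** block11 X +
    (block11 (imat_pow X n) ** block11 (strict_lower X) -
     block11 (strict_lower X) ** block11 (imat_pow X n))"
proof -
  have [simp]: "{Suc 0..2} = {1, 2::nat}" by auto
  have *: "imat_comm (imat_pow X n) (strict_lower X) i j = imat_pow X (Suc n) i j
      - (\<Sum>k=1..j. imat_pow X n i k * X k j) - (\<Sum>k=1..i-1. X i k * imat_pow X n k j)"
    if "1 \<le> i" "1 \<le> j" for i j
    unfolding imat_comm_def imat_mult_strict_lower_right[OF banded_imat_pow[OF X]]
      imat_mult_strict_lower_left[OF that(1)] imat_pow_Suc_right[OF X that] ..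
  have L: "strict_lower X 1 1 = 0" "strict_lower X 1 2 = 0"
      "strict_lower X 2 1 = X 2 1" "strict_lower X 2 2 = 0"
    by (simp_all add: strict_lower_def)
  show ?thesis
    unfolding vec_eq_iff forall_2
    using *[of 1 1] *[of 1 2] *[of 2 1] *[of 2 2] L
    by (simp add: matrix_matrix_mult_def sum_2 del: imat_pow.simps)
qed

text \<open>The outermost diagonals make the first rows and columns of the powers triangular with
  nonzero diagonal; the upper one being constant also makes its time derivative vanish.\<close>

locale band_path =
  fixes J :: "real \<Rightarrow> imat"
  assumes banded: "banded 2 (J t)"
    and upper: "1 \<le> i \<Longrightarrow> J t i (i + 2) = 1"
    and lower: "1 \<le> j \<Longrightarrow> J t (j + 2) j \<noteq> 0"
    and differentiable: "1 \<le> i \<Longrightarrow> 1 \<le> j \<Longrightarrow> (\<lambda>s. J s i j) differentiable (at t)"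
begin

abbreviation L :: "real \<Rightarrow> imat" where
  "L t \<equiv> strict_lower (J t)"

lemma banded_pow: "banded (2 * n) (imat_pow (J t) n)"
  using banded_imat_pow[OF banded, where n = n] by (simp add: mult.commute)

lemma banded_L: "banded 2 (L t)"
  by (rule banded_strict_lower[OF banded])

text \<open>Inside the band the only path of \<open>n\<close> steps from \<open>i\<close> to
  \<open>i + 2 * n\<close> takes the outermost step every time, so the entry is a product of ones;
  in \<open>pow_lower\<close> it is a product of nonzero entries.\<close>

lemma pow_upper: "1 \<le> i \<Longrightarrow> imat_pow (J t) n i (i + 2 * n) = 1"
proof (induction n arbitrary: i)
  case (Suc n)
  have "imat_pow (J t) (Suc n) i (i + 2 * Suc n) =
      (\<Sum>k=1..i+2. J t i k * imat_pow (J t) n k (i + 2 * Suc n))"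
    by (simp add: imat_mult_banded[OF banded order.refl])
  also have "\<dots> = (\<Sum>k\<in>{i+2}. J t i k * imat_pow (J t) n k (i + 2 * Suc n))"
    by (rule sum.mono_neutral_right) (auto simp: bandedD[OF banded_pow])
  also have "\<dots> = 1"
    using upper[OF Suc.prems] Suc.IH[of "i + 2"] by (simp add: algebra_simps)
  finally show ?case .
qed simp

lemma pow_lower: "1 \<le> j \<Longrightarrow> imat_pow (J t) n (j + 2 * n) j \<noteq> 0"
proof (induction n)
  case (Suc n)
  have "imat_pow (J t) (Suc n) (j + 2 * Suc n) j =
      (\<Sum>k=1..j + 2 * Suc n + 2. J t (j + 2 * Suc n) k * imat_pow (J t) n k j)"
    by (simp only: imat_pow.simps imat_mult_banded[OF banded order.refl])
  also have "\<dots> = (\<Sum>k\<in>{j + 2 * n}. J t (j + 2 * Suc n) k * imat_pow (J t) n k j)"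
  proof (rule sum.mono_neutral_right)
    show "\<forall>k\<in>{1..j + 2 * Suc n + 2} - {j + 2 * n}. J t (j + 2 * Suc n) k * imat_pow (J t) n k j = 0"
    proof
      fix k assume "k \<in> {1..j + 2 * Suc n + 2} - {j + 2 * n}"
      then have "k + 2 < j + 2 * Suc n \<or> j + 2 * n < k" by auto
      then show "J t (j + 2 * Suc n) k * imat_pow (J t) n k j = 0"
        using bandedD[OF banded] bandedD[OF banded_pow] by (metis mult_eq_0_iff)
    qed
  qed (use Suc.prems in auto)
  also have "\<dots> \<noteq> 0"
    using lower[of "j + 2 * n"] Suc by simp
  finally show ?case .
qed simp

lemma pow_differentiable:
  "1 \<le> i \<Longrightarrow> 1 \<le> j \<Longrightarrow> (\<lambda>s. imat_pow (J s) n i j) differentiable (at t)"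
proof (induction n arbitrary: i j)
  case (Suc n)
  have "(\<lambda>s. \<Sum>k=1..i+2. J s i k * imat_pow (J s) n k j) differentiable (at t)"
    by (intro differentiable_sum ballI differentiable_mult differentiable Suc) auto
  then show ?case by (simp add: imat_mult_banded[OF banded order.refl])
qed simp

text \<open>Induction on \<open>n\<close>: the product rule for the derivative and the Leibniz rule
  for the commutator have the same shape.\<close>

lemma lax_pow:
  assumes "\<And>i j. 1 \<le> i \<Longrightarrow> 1 \<le> j \<Longrightarrow>
      ((\<lambda>s. J s i j) has_vector_derivative imat_comm (J t) (L t) i j) (at t)"
    and "1 \<le> i" "1 \<le> j"
  shows "((\<lambda>s. imat_pow (J s) n i j) has_vector_derivative
    imat_comm (imat_pow (J t) n) (L t) i j) (at t)"
  using assms(2,3)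
proof (induction n arbitrary: i j)
  case 0
  have "imat_comm (imat_pow (J t) 0) (L t) i j = 0"
    using 0 by (simp add: imat_comm_def imat_mult_one_left imat_mult_one_right)
  then show ?case by simp
next
  case (Suc n)
  \<comment> \<open>The product rule wants one width for \<open>J\<close> and its derivative, and
    the commutator has width 2 + 2.\<close>
  have w: "banded 4 (J s)" for s
    using banded by (auto simp: banded_def)
  have w': "banded 4 (imat_comm (J t) (L t))"
    using banded_imat_comm[OF banded banded_L] by simp
  have "((\<lambda>s. imat_mult (J s) (imat_pow (J s) n) i j) has_vector_derivative
      imat_mult (imat_comm (J t) (L t)) (imat_pow (J t) n) i j +
      imat_mult (J t) (imat_comm (imat_pow (J t) n) (L t)) i j) (at t)"
    by (rule has_vector_derivative_imat_mult[OF w w'])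
      (use assms(1) Suc in auto)
  then show ?case
    by (simp add: imat_comm_mult[OF banded banded_pow banded_L])
qed

text \<open>
  Both the time derivative and the commutator with \<^term>\<open>L t\<close> are derivations, hence so is the
  defect \<open>n \<mapsto> (J^n)' - [J^n, L]\<close>.
\<close>

definition pow_defect :: "real \<Rightarrow> nat \<Rightarrow> imat" where
  "pow_defect t n = (\<lambda>i j. vector_derivative (\<lambda>s. imat_pow (J s) n i j) (at t)
     - imat_comm (imat_pow (J t) n) (L t) i j)"

lemma pow_defect_add:
  assumes "1 \<le> i" "1 \<le> j"
  shows "pow_defect t (m + n) i j =
    imat_mult (pow_defect t m) (imat_pow (J t) n) i j + imat_mult (imat_pow (J t) m) (pow_defect t n) i j"
proof -
  define D where "D n = (\<lambda>i j. vector_derivative (\<lambda>s. imat_pow (J s) n i j) (at t))" for n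
  have D: "((\<lambda>s. imat_pow (J s) n i j) has_vector_derivative D n i j) (at t)"
    if "1 \<le> i" "1 \<le> j" for n i j
    using pow_differentiable[OF that] by (simp add: D_def vector_derivative_works)
  \<comment> \<open>Entries outside the band vanish for all \<open>s\<close>, hence so do their
    derivatives.\<close>
  have bD: "banded (2 * n) (D n)" for n
    unfolding banded_def D_def using bandedD[OF banded_pow] by simp
  have defect: "pow_defect t n = (\<lambda>i j. D n i j - imat_comm (imat_pow (J t) n) (L t) i j)" for n
    by (simp add: pow_defect_def D_def)
  have "((\<lambda>s. imat_mult (imat_pow (J s) m) (imat_pow (J s) n) i j) has_vector_derivative
      imat_mult (D m) (imat_pow (J t) n) i j + imat_mult (imat_pow (J t) m) (D n) i j) (at t)"
    by (rule has_vector_derivative_imat_mult[OF banded_pow bD D D]) (use assms in auto)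
  then have 1: "D (m + n) i j =
      imat_mult (D m) (imat_pow (J t) n) i j + imat_mult (imat_pow (J t) m) (D n) i j"
    unfolding imat_pow_add[OF banded assms(1), symmetric]
    using D[OF assms] vector_derivative_unique_at by blast
  have "imat_comm (imat_pow (J t) (m + n)) (L t) i j =
      imat_comm (imat_mult (imat_pow (J t) m) (imat_pow (J t) n)) (L t) i j"
    unfolding imat_comm_def using assms
    by (intro arg_cong2[of _ _ _ _ "(-)"] imat_mult_cong_row)
      (simp_all add: imat_pow_add[OF banded])
  also have "\<dots> = imat_mult (imat_comm (imat_pow (J t) m) (L t)) (imat_pow (J t) n) i j
      + imat_mult (imat_pow (J t) m) (imat_comm (imat_pow (J t) n) (L t)) i j"
    by (rule imat_comm_mult[OF banded_pow banded_pow banded_L])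
  finally show ?thesis
    unfolding defect 1 imat_mult_diff_left[OF bD banded_imat_comm[OF banded_pow banded_L]]
      imat_mult_diff_right[OF banded_pow] by simp
qed

text \<open>On and above the outermost upper diagonal the entries of the power are constant and both
  products with \<open>L\<close> vanish. The case \<open>j = i + 2 * n\<close> is included because
  that diagonal is identically 1; this makes the row defects strictly lower triangular.\<close>

lemma pow_defect_row:
  assumes "1 \<le> i" "i + 2 * n \<le> j"
  shows "pow_defect t n i j = 0"
proof -
  have const: "imat_pow (J s) n i j = (if j = i + 2 * n then 1 else 0)" for s
    using pow_upper[OF assms(1), of s n] assms by (auto intro: bandedD[OF banded_pow])
  have 1: "imat_mult (imat_pow (J t) n) (L t) i j = 0"
  proof (subst imat_mult_eq_sum[of 0])
    show "imat_pow (J t) n i k * L t k j = 0" for k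
      using assms by (cases "j < k") (auto simp: strict_lower_def bandedD[OF banded_pow])
  qed auto
  have 2: "imat_mult (L t) (imat_pow (J t) n) i j = 0"
    unfolding imat_mult_strict_lower_left[OF assms(1)]
    by (rule sum.neutral) (use assms in \<open>auto intro!: bandedD[OF banded_pow]\<close>)
  show ?thesis
    unfolding pow_defect_def imat_comm_def 1 2 const by simp
qed

text \<open>Below the band both products with \<open>L\<close> equal the same entry of the next
  power, because only entries of \<open>J\<close> below the diagonal contribute and there
  \<open>L\<close> agrees with \<open>J\<close>. The diagonal \<open>i = j + 2 * n\<close> is left
  out, as its entries may vary in time.\<close>

lemma pow_defect_column:
  assumes "1 \<le> j" "j + 2 * n < i"
  shows "pow_defect t n i j = 0"
proof -
  have const: "imat_pow (J s) n i j = 0" for s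
    using assms by (intro bandedD[OF banded_pow]) auto
  have "(\<Sum>k=1..j. imat_pow (J t) n i k * J t k j) = 0"
    by (rule sum.neutral) (use assms in \<open>auto intro!: bandedD[OF banded_pow]\<close>)
  then have 1: "imat_mult (imat_pow (J t) n) (L t) i j = imat_pow (J t) (Suc n) i j"
    using assms by (simp add: imat_mult_strict_lower_right[OF banded_pow]
        imat_pow_Suc_right[OF banded] del: imat_pow.simps)
  have 2: "imat_mult (L t) (imat_pow (J t) n) i j = imat_pow (J t) (Suc n) i j"
    unfolding imat_pow.simps imat_mult_def
    by (rule infsum_cong) (use assms in \<open>auto simp: strict_lower_def bandedD[OF banded_pow]\<close>)
  show ?thesis
    unfolding pow_defect_def imat_comm_def 1 2 const by simp
qed

lemma lax_if_moments:
  assumes mom: "\<And>n. ((\<lambda>s. block11 (imat_pow (J s) n)) has_vector_derivative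
      block11 (imat_comm (imat_pow (J t) n) (L t))) (at t)"
    and ij: "1 \<le> i" "1 \<le> j"
  shows "((\<lambda>s. J s i j) has_vector_derivative imat_comm (J t) (L t) i j) (at t)"
proof -
  have zero: "pow_defect t n i j = 0" if "i \<in> {1, 2}" "j \<in> {1, 2}" for n i j
  proof -
    have "((\<lambda>s. block11 (imat_pow (J s) n) $ p $ q) has_vector_derivative
        block11 (imat_comm (imat_pow (J t) n) (L t)) $ p $ q) (at t)" for p q
      by (intro bounded_linear.has_vector_derivative[OF bounded_linear_vec_nth] mom)
    from this[of 1 1] this[of 1 2] this[of 2 1] this[of 2 2]
    have "((\<lambda>s. imat_pow (J s) n i j) has_vector_derivative
        imat_comm (imat_pow (J t) n) (L t) i j) (at t)"
      using that by auto
    then show ?thesis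
      by (simp add: pow_defect_def vector_derivative_at)
  qed
  \<comment> \<open>Write \<open>p = r p + 2 * k p\<close> with \<open>r p \<in> {1, 2}\<close>. With rows \<open>J^(k p) (r p) _\<close> and columns
    \<open>J^(k q) _ (r q)\<close> the block Hankel matrix of the moments becomes a product of a lower and an
    upper triangular matrix, and the defects of the two factors are strictly lower and upper
    triangular.\<close>
  define k where "k p = (p - 1) div 2" for p :: nat
  define r where "r p = p - 2 * k p" for p :: nat
  have r: "r p \<in> {1, 2}" "1 \<le> r p" "r p + 2 * k p = p" if "1 \<le> p" for p
  proof -
    show "r p \<in> {1, 2}" using that unfolding r_def k_def by (auto; presburger)
    then show "1 \<le> r p" "r p + 2 * k p = p" by (auto simp: r_def)
  qed
  have E0: "pow_defect t (k p) (r p) q = 0" if "1 \<le> p" "1 \<le> q" for p q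
  proof (rule triangular_product_eq_0[where
        u' = "\<lambda>p j. pow_defect t (k p) (r p) j" and v' = "\<lambda>j q. pow_defect t (k q) j (r q)" and
        u = "\<lambda>p j. imat_pow (J t) (k p) (r p) j" and v = "\<lambda>j q. imat_pow (J t) (k q) j (r q)"])
    show "imat_pow (J t) (k p) (r p) p \<noteq> 0" if "1 \<le> p" for p
      using pow_upper[of "r p" t "k p"] r[OF that] by simp
    show "imat_pow (J t) (k p) p (r p) \<noteq> 0" if "1 \<le> p" for p
      using pow_lower[of "r p" t "k p"] r[OF that] by simp
    show u: "imat_pow (J t) (k p) (r p) j = 0" if "1 \<le> p" "p < j" for p j
      using r[OF that(1)] that(2) by (intro bandedD[OF banded_pow]) auto
    show "imat_pow (J t) (k p) j (r p) = 0" if "1 \<le> p" "p < j" for p j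
      using r[OF that(1)] that(2) by (intro bandedD[OF banded_pow]) auto
    show u': "pow_defect t (k p) (r p) j = 0" if "1 \<le> p" "p \<le> j" for p j
      using r[OF that(1)] that(2) by (intro pow_defect_row) auto
    show "pow_defect t (k p) j (r p) = 0" if "1 \<le> p" "p < j" for p j
      using r[OF that(1)] that(2) by (intro pow_defect_column) auto
    \<comment> \<open>The left side is entry \<open>(r p, r q)\<close> of the defect of the power
      \<open>k p + k q\<close>, a corner entry, hence 0. The range up to \<open>p + q\<close>
      suffices because the row factors vanish beyond \<open>p\<close>.\<close>
    show "(\<Sum>j=1..p+q. pow_defect t (k p) (r p) j * imat_pow (J t) (k q) j (r q)) +
        (\<Sum>j=1..p+q. imat_pow (J t) (k p) (r p) j * pow_defect t (k q) j (r q)) = 0"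
      if "1 \<le> p" "1 \<le> q" for p q
    proof -
      have "imat_mult (pow_defect t (k p)) (imat_pow (J t) (k q)) (r p) (r q) =
          (\<Sum>j=1..p+q. pow_defect t (k p) (r p) j * imat_pow (J t) (k q) j (r q))"
        by (rule imat_mult_eq_sum) (use u' that in simp)
      moreover have "imat_mult (imat_pow (J t) (k p)) (pow_defect t (k q)) (r p) (r q) =
          (\<Sum>j=1..p+q. imat_pow (J t) (k p) (r p) j * pow_defect t (k q) j (r q))"
        by (rule imat_mult_eq_sum) (use u that in simp)
      ultimately show ?thesis
        using pow_defect_add[OF r(2)[OF that(1)] r(2)[OF that(2)], of t "k p" "k q"]
          zero[OF r(1)[OF that(1)] r(1)[OF that(2)]] by simp
    qed
  qed (use that in auto)
  \<comment> \<open>Passing from \<open>p\<close> to \<open>p + 2\<close> raises \<open>k\<close> by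
    one and keeps \<open>r\<close>. By \<open>E0\<close> at \<open>p + 2\<close> and at
    \<open>p\<close>, row \<open>r p\<close> of the power \<open>k p\<close> times
    \<open>pow_defect t 1\<close> is 0; these rows are unitriangular, so induction isolates row
    \<open>p\<close> of the defect.\<close>
  have "pow_defect t 1 p q = 0" if "1 \<le> p" "1 \<le> q" for p q
    using that(1)
  proof (induction p rule: less_induct)
    case (less p)
    have "k (p + 2) = k p + 1"
      using less.prems by (cases p) (simp_all add: k_def)
    moreover from this have "r (p + 2) = r p"
      by (simp add: r_def)
    ultimately have "0 = pow_defect t (k p + 1) (r p) q"
      using E0[of "p + 2" q] that(2) by simp
    also have "\<dots> = imat_mult (pow_defect t (k p)) (imat_pow (J t) 1) (r p) q
        + imat_mult (imat_pow (J t) (k p)) (pow_defect t 1) (r p) q"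
      by (rule pow_defect_add) (use r less.prems that in auto)
    also have "imat_mult (pow_defect t (k p)) (imat_pow (J t) 1) (r p) q = 0"
      using E0[OF less.prems] by (subst imat_mult_eq_sum[of 0]) auto
    also have "imat_mult (imat_pow (J t) (k p)) (pow_defect t 1) (r p) q =
        (\<Sum>j=1..p. imat_pow (J t) (k p) (r p) j * pow_defect t 1 j q)"
      using r[OF less.prems] by (intro imat_mult_banded[OF banded_pow]) auto
    also have "\<dots> = (\<Sum>j\<in>{p}. imat_pow (J t) (k p) (r p) j * pow_defect t 1 j q)"
      by (rule sum.mono_neutral_right) (use less in auto)
    also have "\<dots> = pow_defect t 1 p q"
      using pow_upper[of "r p" t "k p"] r[OF less.prems] by simp
    finally show ?case by simp
  qed
  from this[OF ij] have "vector_derivative (\<lambda>s. J s i j) (at t) = imat_comm (imat_pow (J t) 1) (L t) i j"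
    using ij(2) by (simp add: pow_defect_def imat_pow_1 del: One_nat_def imat_pow.simps)
  also have "\<dots> = imat_comm (J t) (L t) i j"
    unfolding imat_comm_def using ij
    by (intro arg_cong2[of _ _ _ _ "(-)"] imat_mult_cong_row) (simp_all only: imat_pow_1)
  finally show ?thesis
    using differentiable[OF ij, of t] vector_derivative_works by metis
qed

end

section \<open>From the Lax equation to the lattice equations\<close>

lemma banded_band_matrix: "banded 2 (band_matrix a b c d t)"
  by (auto simp: banded_def band_matrix_def)

lemma band_path_band_matrix:
  assumes "\<And>n t. 1 \<le> n \<Longrightarrow>
      a n differentiable (at t) \<and> b n differentiable (at t) \<and>
      c n differentiable (at t) \<and> d n differentiable (at t)"
    and "\<And>n t. 1 \<le> n \<Longrightarrow> d n t \<noteq> 0"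
  shows "band_path (band_matrix a b c d)"
proof
  fix i j :: nat and t assume "1 \<le> i" "1 \<le> j"
  then have diff: "b i differentiable (at t)" "a (i + 1) differentiable (at t)"
      "c j differentiable (at t)" "d j differentiable (at t)"
    using assms(1)[of i t] assms(1)[of j t] assms(1)[of "i + 1" t] by auto
  have if_diff: "(\<lambda>s. if P then f s else g s) differentiable (at t)"
    if "f differentiable (at t)" "g differentiable (at t)" for P and f g :: "real \<Rightarrow> complex"
    using that by (cases P) auto
  show "(\<lambda>s. band_matrix a b c d s i j) differentiable (at t)"
    unfolding band_matrix_def by (intro if_diff diff differentiable_const)
qed (use assms(2) in \<open>auto simp: band_matrix_def intro: banded_band_matrix[unfolded band_matrix_def]\<close>)

text \<open>Column \<open>j\<close> of the lower part holds only \<open>c j\<close> and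
  \<open>d j\<close>, row \<open>i\<close> only \<open>c (i - 1)\<close> and
  \<open>d (i - 2)\<close>. For \<open>i \<le> 2\<close> truncated subtraction reaches index 0,
  where these coefficients vanish.\<close>

lemma imat_comm_band_matrix:
  fixes a b c d :: "nat \<Rightarrow> real \<Rightarrow> complex"
  assumes "c 0 t = 0" "d 0 t = 0" "1 \<le> i" "1 \<le> j"
  defines "X \<equiv> band_matrix a b c d t"
  shows "imat_comm X (strict_lower X) i j =
    X i (j + 1) * c j t + X i (j + 2) * d j t - c (i - 1) t * X (i - 1) j - d (i - 2) t * X (i - 2) j"
proof -
  have "imat_mult X (strict_lower X) i j = (\<Sum>k=1..i+j+2. X i k * strict_lower X k j)"
    using banded_band_matrix unfolding X_def by (rule imat_mult_banded) simp
  also have "\<dots> = (\<Sum>k\<in>{j+1, j+2}. X i k * strict_lower X k j)"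
    by (rule sum.mono_neutral_right)
      (use assms(3) in \<open>auto simp: strict_lower_def X_def band_matrix_def\<close>)
  also have "\<dots> = X i (j + 1) * c j t + X i (j + 2) * d j t"
    by (simp add: strict_lower_def X_def band_matrix_def)
  finally have 1: "imat_mult X (strict_lower X) i j = X i (j + 1) * c j t + X i (j + 2) * d j t" .
  have "imat_mult (strict_lower X) X i j = (\<Sum>k=1..i-1. X i k * X k j)"
    by (rule imat_mult_strict_lower_left[OF assms(3)])
  also have "\<dots> = c (i - 1) t * X (i - 1) j + d (i - 2) t * X (i - 2) j"
  proof -
    consider "i = 1" | "i = 2" | m where "i = m + 3"
      using assms(3) that(3)[of "i - 3"] by fastforce
    then show ?thesis
    proof cases
      case 3
      then have "(\<Sum>k=1..i-1. X i k * X k j) = (\<Sum>k\<in>{m+1, m+2}. X i k * X k j)"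
        by (intro sum.mono_neutral_right) (auto simp: X_def band_matrix_def)
      then show ?thesis
        using 3 by (simp add: X_def band_matrix_def add.commute)
    qed (use assms in \<open>auto simp: band_matrix_def numeral_2_eq_2\<close>)
  qed
  finally show ?thesis
    unfolding imat_comm_def 1 by simp
qed

text \<open>Each family of equations sits on one diagonal. The superdiagonal holds
  \<open>a (i + 1)\<close> with \<open>i \<ge> 1\<close>, so it gives the equations for
  \<open>a n\<close> with \<open>n \<ge> 2\<close>.\<close>

lemma lattice_solution_entries_iff_lax:
  fixes a b c d :: "nat \<Rightarrow> real \<Rightarrow> complex"
  assumes zero: "\<And>t. c 0 t = 0" "\<And>t. d 0 t = 0"
  defines "J \<equiv> band_matrix a b c d"
  shows "lattice_solution_entries a b c d \<longleftrightarrow> (\<forall>t i j. 1 \<le> i \<longrightarrow> 1 \<le> j \<longrightarrow>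
    ((\<lambda>s. J s i j) has_vector_derivative imat_comm (J t) (strict_lower (J t)) i j) (at t))"
    (is "_ \<longleftrightarrow> (\<forall>t i j. _ \<longrightarrow> _ \<longrightarrow> ?lax t i j)")
proof -
  note comm = imat_comm_band_matrix[where a = a and b = b and c = c and d = d, OF zero, folded J_def]
  have J_nth: "J t i j = (if j = i then b i t else if j = i + 1 then a (i + 1) t
      else if j = i + 2 then 1 else if i = j + 1 then c j t else if i = j + 2 then d j t else 0)"
    for t i j by (simp add: J_def band_matrix_def)
  have up: "?lax t i (i + 1) \<longleftrightarrow>
      (a (i + 1) has_vector_derivative (c (i + 1) t - c (i - 1) t)) (at t)" if i1: "1 \<le> i" for t i
  proof -
    obtain m where [simp]: "i = Suc m" using i1 by (cases i) auto
    have *: "imat_comm (J t) (strict_lower (J t)) i (i + 1) = c (i + 1) t - c (i - 1) t"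
      by (cases m) (simp_all add: comm J_nth zero)
    show ?thesis unfolding * by (simp add: J_nth)
  qed
  have diag: "?lax t i i \<longleftrightarrow> (b i has_vector_derivative
      (c i t * a (i + 1) t - c (i - 1) t * a i t + d i t - d (i - 2) t)) (at t)" if i1: "1 \<le> i" for t i
  proof -
    have *: "imat_comm (J t) (strict_lower (J t)) i i =
        c i t * a (i + 1) t - c (i - 1) t * a i t + d i t - d (i - 2) t"
    proof -
      obtain m where [simp]: "i = Suc m" using i1 by (cases i) auto
      show ?thesis by (cases m) (simp_all add: comm J_nth zero)
    qed
    show ?thesis unfolding * by (simp add: J_nth)
  qed
  have low1: "?lax t (i + 1) i \<longleftrightarrow> (c i has_vector_derivative
      (c i t * (b (i + 1) t - b i t) + d i t * a (i + 2) t - d (i - 1) t * a i t)) (at t)"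
    if i1: "1 \<le> i" for t i
  proof -
    have *: "imat_comm (J t) (strict_lower (J t)) (i + 1) i =
        c i t * (b (i + 1) t - b i t) + d i t * a (i + 2) t - d (i - 1) t * a i t"
    proof -
      obtain m where [simp]: "i = Suc m" using i1 by (cases i) auto
      show ?thesis by (cases m) (simp_all add: comm J_nth zero algebra_simps)
    qed
    show ?thesis unfolding * by (simp add: J_nth)
  qed
  have low2: "?lax t (i + 2) i \<longleftrightarrow>
      (d i has_vector_derivative (d i t * (b (i + 2) t - b i t))) (at t)" if i1: "1 \<le> i" for t i
  proof -
    have *: "imat_comm (J t) (strict_lower (J t)) (i + 2) i = d i t * (b (i + 2) t - b i t)"
    proof -
      obtain m where [simp]: "i = Suc m" using i1 by (cases i) auto
      show ?thesis by (simp add: comm J_nth algebra_simps)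
    qed
    show ?thesis unfolding * by (simp add: J_nth)
  qed
  have far: "?lax t i j" if i1: "1 \<le> i" and j1: "1 \<le> j" and ij: "i + 2 \<le> j \<or> j + 3 \<le> i" for t i j
  proof -
    have const: "(\<lambda>s. J s i j) = (\<lambda>s. if j = i + 2 then 1 else 0)"
      using i1 j1 ij by (auto simp: J_nth)
    have "imat_comm (J t) (strict_lower (J t)) i j = 0"
    proof -
      obtain m where [simp]: "i = Suc m" using i1 by (cases i) auto
      obtain m' where [simp]: "j = Suc m'" using j1 by (cases j) auto
      \<comment> \<open>On the diagonals \<open>i = j + 3\<close> and \<open>i = j + 4\<close> the
        products of lower entries cancel; in the other two cases every term is 0.\<close>
      consider "Suc m < m'" | "m = Suc (Suc (Suc m'))" | "m = Suc (Suc (Suc (Suc m')))" | "m' + 5 \<le> m"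
        using ij by force
      then show ?thesis
      proof cases
        case 1
        then show ?thesis by (cases m) (simp_all add: comm J_nth zero)
      next
        case 4
        then show ?thesis by (auto simp: comm J_nth)
      qed (simp_all add: comm J_nth)
    qed
    then show ?thesis unfolding const by simp
  qed
  show ?thesis
  proof
    assume sol: "lattice_solution_entries a b c d"
    show "\<forall>t i j. 1 \<le> i \<longrightarrow> 1 \<le> j \<longrightarrow> ?lax t i j"
    proof (intro allI impI)
      fix t i j assume ij: "1 \<le> (i::nat)" "1 \<le> (j::nat)"
      consider "j = i + 1" | "j = i" | "i = j + 1" | "i = j + 2" | "i + 2 \<le> j \<or> j + 3 \<le> i"
        by linarith
      then show "?lax t i j"
      proof cases
        case 1
        then show ?thesis
          using sol[unfolded lattice_solution_entries_def, rule_format, of "i + 1" t] ij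
          by (simp only: up) simp
      next
        case 2
        then show ?thesis
          using sol[unfolded lattice_solution_entries_def, rule_format, of i t] ij
          by (simp only: diag)
      next
        case 3
        then show ?thesis
          using sol[unfolded lattice_solution_entries_def, rule_format, of j t] ij
          by (simp only: low1)
      next
        case 4
        then show ?thesis
          using sol[unfolded lattice_solution_entries_def, rule_format, of j t] ij
          by (simp only: low2)
      qed (use far ij in blast)
    qed
  next
    assume lax: "\<forall>t i j. 1 \<le> i \<longrightarrow> 1 \<le> j \<longrightarrow> ?lax t i j"
    show "lattice_solution_entries a b c d"
      unfolding lattice_solution_entries_def
    proof (intro allI impI conjI)
      fix n t assume n: "1 \<le> (n::nat)"
      show "(a n has_vector_derivative (c n t - c (n - 2) t)) (at t)" if "2 \<le> n"
        using up[of "n - 1" t] lax that by (simp add: numeral_2_eq_2)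
      show "(b n has_vector_derivative
          (c n t * a (n + 1) t - c (n - 1) t * a n t + d n t - d (n - 2) t)) (at t)"
        using diag[OF n] lax n by blast
      show "(c n has_vector_derivative
          (c n t * (b (n + 1) t - b n t) + d n t * a (n + 2) t - d (n - 1) t * a n t)) (at t)"
        using low1[OF n] lax n by auto
      show "(d n has_vector_derivative (d n t * (b (n + 2) t - b n t))) (at t)"
        using low2[OF n] lax n by auto
    qed
  qed
qed

section \<open>The Weyl function\<close>

text \<open>The M-test makes the series of derivatives converge uniformly; convergence at the single
  point \<open>y\<close> then spreads to every \<open>x\<close>.\<close>

lemma has_vector_derivative_suminf:
  fixes f f' :: "nat \<Rightarrow> real \<Rightarrow> 'a::banach"
  assumes der: "\<And>n x. (f n has_vector_derivative f' n x) (at x)"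
    and bound: "\<And>n x. norm (f' n x) \<le> M n" and M: "summable M"
    and sm: "summable (\<lambda>n. f n y)"
  shows "summable (\<lambda>n. f n x)"
    and "((\<lambda>x. \<Sum>n. f n x) has_vector_derivative (\<Sum>n. f' n x)) (at x)"
proof -
  have "\<exists>g. \<forall>x\<in>UNIV. (\<lambda>n. f n x) sums g x \<and>
      (g has_derivative (\<lambda>h. h *\<^sub>R (\<Sum>n. f' n x))) (at x within UNIV)"
  proof (rule has_derivative_series)
    show "\<And>n x. (f n has_derivative (\<lambda>h. h *\<^sub>R f' n x)) (at x within UNIV)"
      using der by (simp add: has_vector_derivative_def)
    show "(\<lambda>n. f n y) sums (\<Sum>n. f n y)"
      using sm by (rule summable_sums)
    fix e :: real assume "0 < e"
    have "uniform_limit UNIV (\<lambda>n x. \<Sum>i<n. f' i x) (\<lambda>x. \<Sum>i. f' i x) sequentially"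
      by (rule Weierstrass_m_test[OF bound M])
    from uniform_limitD[OF this \<open>0 < e\<close>]
    show "\<forall>\<^sub>F n in sequentially. \<forall>x\<in>UNIV. \<forall>h. norm ((\<Sum>i<n. h *\<^sub>R f' i x) - h *\<^sub>R (\<Sum>n. f' n x)) \<le> e * norm h"
    proof (rule eventually_mono)
      fix n assume *: "\<forall>x\<in>UNIV. dist (\<Sum>i<n. f' i x) (\<Sum>i. f' i x) < e"
      have "norm ((\<Sum>i<n. h *\<^sub>R f' i x) - h *\<^sub>R (\<Sum>n. f' n x)) \<le> e * norm h" for x h
      proof -
        have "norm ((\<Sum>i<n. h *\<^sub>R f' i x) - h *\<^sub>R (\<Sum>n. f' n x)) =
            norm h * norm ((\<Sum>i<n. f' i x) - (\<Sum>n. f' n x))"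
          by (simp add: scaleR_sum_right[symmetric] scaleR_diff_right[symmetric])
        also have "\<dots> \<le> norm h * e"
          using * by (intro mult_left_mono) (auto simp: dist_norm intro: less_imp_le)
        finally show ?thesis by (simp add: mult.commute)
      qed
      then show "\<forall>x\<in>UNIV. \<forall>h. norm ((\<Sum>i<n. h *\<^sub>R f' i x) - h *\<^sub>R (\<Sum>n. f' n x)) \<le> e * norm h"
        by blast
    qed
  qed auto
  then obtain g where g: "\<And>x. (\<lambda>n. f n x) sums g x"
      "\<And>x. (g has_vector_derivative (\<Sum>n. f' n x)) (at x)"
    by (auto simp: has_vector_derivative_def)
  have "g = (\<lambda>x. \<Sum>n. f n x)"
    using g(1) by (auto simp: sums_iff)
  with g show "summable (\<lambda>n. f n x)"
    "((\<lambda>x. \<Sum>n. f n x) has_vector_derivative (\<Sum>n. f' n x)) (at x)"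
    by (auto simp: sums_iff)
qed

section \<open>Complex 2 x 2 matrices and Laurent series with matrix coefficients\<close>

lemma cscale_nth [simp]: "cscale z A $ i $ j = z * A $ i $ j"
  by (simp add: cscale_def)

lemma norm_cscale: "norm (cscale z A) = cmod z * norm A"
  by (simp add: cscale_def norm_vec_def norm_mult L2_set_right_distrib)

lemma bounded_linear_cscale: "bounded_linear (cscale z)"
  by (rule bounded_linear_intro[where K = "cmod z"])
    (auto simp: vec_eq_iff algebra_simps norm_cscale)

lemma linear_cscale: "linear (cscale z)"
  by (rule bounded_linear.linear[OF bounded_linear_cscale])

lemma bounded_bilinear_matrix_mult:
  "bounded_bilinear ((**) :: complex^2^2 \<Rightarrow> complex^2^2 \<Rightarrow> complex^2^2)"
  unfolding bilinear_conv_bounded_bilinear[symmetric] bilinear_def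
  by (auto intro!: linearI simp: vec_eq_iff matrix_matrix_mult_def sum_2 algebra_simps)

lemma norm_matrix_le_entries:
  fixes A :: "complex^2^2"
  assumes "\<And>i j. cmod (A $ i $ j) \<le> B"
  shows "norm A \<le> 4 * B"
proof -
  have "norm A \<le> (\<Sum>i\<in>UNIV. \<Sum>j\<in>UNIV. cmod (A $ i $ j))"
    unfolding norm_vec_def
    by (rule order.trans[OF L2_set_le_sum]) (auto intro!: sum_mono L2_set_le_sum)
  also have "\<dots> \<le> (\<Sum>i\<in>(UNIV::2 set). \<Sum>j\<in>(UNIV::2 set). B)"
    by (intro sum_mono assms)
  finally show ?thesis by simp
qed

lemma matrix_eq_sum_entries:
  fixes A :: "complex^2^2"
  shows "A = (\<Sum>p\<in>UNIV. \<Sum>q\<in>UNIV. (\<chi> i j. if i = p \<and> j = q then A $ p $ q else 0))"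
  by (simp add: vec_eq_iff forall_2 sum_2)

lemma bounded_linear_matrix_unit:
  "bounded_linear (\<lambda>z. (\<chi> i j. if i = p \<and> j = q then z else 0) :: complex^2^2)"
  unfolding linear_conv_bounded_linear[symmetric]
  by (rule linearI) (auto simp: vec_eq_iff)

lemma has_vector_derivative_matrix:
  fixes F :: "real \<Rightarrow> complex^2^2"
  assumes "\<And>p q. ((\<lambda>s. F s $ p $ q) has_vector_derivative F' $ p $ q) (at t)"
  shows "(F has_vector_derivative F') (at t)"
proof -
  have "((\<lambda>s. \<Sum>p\<in>UNIV. \<Sum>q\<in>UNIV. (\<chi> i j. if i = p \<and> j = q then F s $ p $ q else 0) :: complex^2^2)
      has_vector_derivative (\<Sum>p\<in>UNIV. \<Sum>q\<in>UNIV. (\<chi> i j. if i = p \<and> j = q then F' $ p $ q else 0))) (at t)"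
    by (intro has_vector_derivative_sum bounded_linear.has_vector_derivative[OF bounded_linear_matrix_unit]
        assms)
  then show ?thesis
    unfolding matrix_eq_sum_entries[symmetric] .
qed

text \<open>The substitution \<open>w = 1 / z\<close> gives a power series that vanishes near 0. Its
  coefficients are shifted by one because the Laurent series starts at \<open>1 / z\<close>.\<close>

lemma laurent_coeffs_eq_0:
  fixes e :: "nat \<Rightarrow> complex"
  assumes "0 \<le> S" and "\<And>z. S < cmod z \<Longrightarrow> (\<lambda>n. e n / z ^ (n + 1)) sums 0"
  shows "e n = 0"
proof (rule ccontr)
  assume "e n \<noteq> 0"
  define a where "a n = (case n of 0 \<Rightarrow> 0 | Suc m \<Rightarrow> e m)" for n
  \<comment> \<open>The radius \<open>1 / (S + 1)\<close> is positive also for \<open>S = 0\<close>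
    and forces \<open>S < cmod (1 / w)\<close>.\<close>
  have sums: "(\<lambda>n. a n * (w - 0) ^ n) sums 0" if "norm (w - 0) < 1 / (S + 1)" for w
  proof (cases "w = 0")
    case True
    have "(\<lambda>n. a n * 0 ^ n) = (\<lambda>n. 0)" by (auto simp: a_def split: nat.split)
    with True show ?thesis by simp
  next
    case False
    have "S < cmod (1 / w)"
      using that False \<open>0 \<le> S\<close> zero_less_norm_iff[of w] by (simp add: norm_divide field_simps del: zero_less_norm_iff)
    from assms(2)[OF this] have "(\<lambda>n. a (Suc n) * w ^ Suc n) sums 0"
      using False by (simp add: a_def power_divide power_one_over)
    then show ?thesis
      by (subst (asm) sums_Suc_iff) (simp add: a_def)
  qed
  \<comment> \<open>Zeros of a power series with a nonzero coefficient are isolated, which is absurd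
    for the zero function.\<close>
  obtain s where s: "0 < s" "\<And>z::complex. z \<in> cball 0 s - {0} \<Longrightarrow> (0::complex) \<noteq> 0"
    by (rule powser_0_nonzero[where a = a and \<xi> = 0 and f = "\<lambda>_. 0" and m = "Suc n", OF _ sums])
      (use \<open>0 \<le> S\<close> \<open>e n \<noteq> 0\<close> in \<open>auto simp: a_def\<close>)
  have "complex_of_real s \<in> cball 0 s - {0}" using s(1) by simp
  with s(2) show False by blast
qed

lemma summable_cscale:
  assumes "\<And>n. norm (m n) \<le> C * S ^ n" "S < cmod z" "0 \<le> S"
  shows "summable (\<lambda>n. C * S ^ n / cmod z ^ (n + 1))"
    and "norm (cscale (1 / z ^ (n + 1)) (m n)) \<le> C * S ^ n / cmod z ^ (n + 1)"
    and "summable (\<lambda>n. cscale (1 / z ^ (n + 1)) (m n))"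
proof -
  have "summable (\<lambda>n. C / cmod z * (S / cmod z) ^ n)"
    using assms(2,3) by (intro summable_mult summable_geometric) (simp add: divide_less_eq)
  then show 1: "summable (\<lambda>n. C * S ^ n / cmod z ^ (n + 1))"
    by (simp add: power_divide)
  have 2: "norm (cscale (1 / z ^ (n + 1)) (m n)) \<le> C * S ^ n / cmod z ^ (n + 1)" for n
    using divide_right_mono[OF assms(1)[of n], of "cmod z ^ (n + 1)"]
    by (simp add: norm_cscale norm_divide norm_power norm_mult)
  show "norm (cscale (1 / z ^ (n + 1)) (m n)) \<le> C * S ^ n / cmod z ^ (n + 1)" by (rule 2)
  show "summable (\<lambda>n. cscale (1 / z ^ (n + 1)) (m n))"
    by (rule summable_comparison_test'[OF 1 2])
qed

text \<open>
  No bound on the derivatives of \<^term>\<open>m\<close> is available, so in the direction from the series to its terms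
  the antiderivatives of \<^term>\<open>g\<close> are summed instead.
\<close>

lemma laurent_series_derivative_iff:
  fixes m g :: "nat \<Rightarrow> real \<Rightarrow> complex^2^2"
  assumes S: "0 \<le> S"
    and m: "\<And>n t. norm (m n t) \<le> C * S ^ n"
    and g: "\<And>n t. norm (g n t) \<le> D * S ^ n"
    and cont: "\<And>n t. isCont (g n) t"
  shows "(\<forall>t z. S < cmod z \<longrightarrow> ((\<lambda>s. \<Sum>n. cscale (1 / z ^ (n + 1)) (m n s)) has_vector_derivative
      (\<Sum>n. cscale (1 / z ^ (n + 1)) (g n t))) (at t)) \<longleftrightarrow>
    (\<forall>n t. (m n has_vector_derivative g n t) (at t))" (is "?series \<longleftrightarrow> ?terms")
proof
  note termwise = bounded_linear.has_vector_derivative[OF bounded_linear_cscale]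
  show ?series if ?terms
  proof (intro allI impI)
    fix t z assume z: "S < cmod z"
    show "((\<lambda>s. \<Sum>n. cscale (1 / z ^ (n + 1)) (m n s)) has_vector_derivative
        (\<Sum>n. cscale (1 / z ^ (n + 1)) (g n t))) (at t)"
    proof (rule has_vector_derivative_suminf(2)[where y = 0 and x = t and
          f = "\<lambda>n s. cscale (1 / z ^ (n + 1)) (m n s)" and f' = "\<lambda>n s. cscale (1 / z ^ (n + 1)) (g n s)"])
      show "((\<lambda>s. cscale (1 / z ^ (n + 1)) (m n s)) has_vector_derivative
          cscale (1 / z ^ (n + 1)) (g n s)) (at s)" for n s
        using that by (intro termwise) blast
    qed (rule summable_cscale(2,1,3)[OF _ z S], rule m g)+
  qed
  show ?terms if series: ?series
  proof -
    have "\<exists>F. \<forall>t. (F has_vector_derivative g n t) (at t)" for n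
      using einterval_antiderivative[of "- \<infinity>" "\<infinity>" "g n"] cont by auto
    then obtain F0 where F0: "\<And>n t. (F0 n has_vector_derivative g n t) (at t)" by metis
    \<comment> \<open>Normalized to vanish at 0, so that the series of antiderivatives trivially
      converges at one point.\<close>
    define F where "F n t = F0 n t - F0 n 0" for n t
    have F: "(F n has_vector_derivative g n t) (at t)" for n t
      unfolding F_def using has_vector_derivative_diff[OF F0 has_vector_derivative_const] by simp
    have eq: "m n t - F n t - m n 0 = 0" for n t
    proof -
      have sums: "(\<lambda>n. cscale (1 / z ^ (n + 1)) (m n t - F n t - m n 0)) sums 0" if z: "S < cmod z" for z
      proof -
        let ?c = "\<lambda>n. cscale (1 / z ^ (n + 1))"
        have F_sum: "summable (\<lambda>n. ?c n (F n x))"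
          "((\<lambda>x. \<Sum>n. ?c n (F n x)) has_vector_derivative (\<Sum>n. ?c n (g n x))) (at x)" for x
          by (rule has_vector_derivative_suminf[where y = 0 and x = x and
                f = "\<lambda>n s. ?c n (F n s)" and f' = "\<lambda>n s. ?c n (g n s)",
                OF termwise[OF F] summable_cscale(2,1)[OF g z S]],
              simp add: F_def linear_0[OF linear_cscale])+
        have m_sum: "summable (\<lambda>n. ?c n (m n x))" for x
          by (rule summable_cscale(3)[OF m z S])
        \<comment> \<open>Both series have the same derivative, so \<open>?H\<close> is constant;
          comparing \<open>t\<close> with 0 gives a Laurent series with sum 0 for every large
          \<open>z\<close>.\<close>
        let ?H = "\<lambda>x. (\<Sum>n. ?c n (m n x)) - (\<Sum>n. ?c n (F n x))"
        have "(?H has_vector_derivative 0) (at x within UNIV)" for x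
          using has_vector_derivative_diff[OF _ F_sum(2)] series z by fastforce
        then obtain c where "\<And>x. ?H x = c"
          using has_vector_derivative_zero_constant[of UNIV ?H] by auto
        then have "?H t = ?H 0" by simp
        moreover have "(\<Sum>n. ?c n (F n 0)) = 0"
          by (simp add: F_def linear_0[OF linear_cscale])
        moreover have "(\<lambda>n. ?c n (m n t - F n t - m n 0)) sums
            ((\<Sum>n. ?c n (m n t)) - (\<Sum>n. ?c n (F n t)) - (\<Sum>n. ?c n (m n 0)))"
          unfolding linear_diff[OF linear_cscale]
          by (intro sums_diff summable_sums m_sum F_sum(1))
        ultimately show ?thesis by simp
      qed
      have "(m n t - F n t - m n 0) $ i $ j = 0" for i j
      proof (rule laurent_coeffs_eq_0[OF S])
        fix z assume "S < cmod z"
        from sums_vec_nth[OF sums_vec_nth[OF sums[OF this]], of i j]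
        show "(\<lambda>n. (m n t - F n t - m n 0) $ i $ j / z ^ (n + 1)) sums 0"
          by simp
      qed
      then show ?thesis by (simp add: vec_eq_iff)
    qed
    have "(\<lambda>t. F n t + m n 0) = m n" for n
    proof
      show "F n t + m n 0 = m n t" for t
        using eq[of n t] unfolding diff_diff_eq right_minus_eq by (rule sym)
    qed
    moreover have "((\<lambda>t. F n t + m n 0) has_vector_derivative g n t) (at t)" for n t
      using has_vector_derivative_add[OF F[of n t] has_vector_derivative_const[of "m n 0"]] by simp
    ultimately show ?terms by simp
  qed
qed


text \<open>Multiplication by \<open>z\<close> shifts the series by one place, and the term
  \<open>m 0 = mat 1\<close> that drops out accounts for \<open>- mat 1\<close>.\<close>

lemma sums_weyl_rhs:
  assumes R: "(\<lambda>n. cscale (1 / z ^ (n + 1)) (m n)) sums R" and "m 0 = mat 1" and "z \<noteq> 0"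
  shows "(\<lambda>n. cscale (1 / z ^ (n + 1)) (m (Suc n) - m n ** A + (m n ** L - L ** m n))) sums
    (R ** (cscale z (mat 1) - A) - mat 1 + (R ** L - L ** R))"
proof -
  have left: "cscale w (X ** Y) = cscale w X ** Y" and right: "cscale w (X ** Y) = X ** cscale w Y" for w X Y
    by (simp_all add: vec_eq_iff matrix_matrix_mult_def sum_2 algebra_simps)
  have Suc: "(\<lambda>n. cscale (1 / z ^ (Suc n + 1)) (m (Suc n))) sums (R - cscale (1 / z) (mat 1))"
    using R assms(2) by (subst sums_Suc_iff) simp
  have shift: "(\<lambda>n. cscale (1 / z ^ (n + 1)) (m (Suc n))) sums (cscale z R - mat 1)"
  proof -
    have "cscale z (R - cscale (1 / z) (mat 1)) = cscale z R - mat 1"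
      "\<And>n. cscale z (cscale (1 / z ^ (Suc n + 1)) (m (Suc n))) = cscale (1 / z ^ (n + 1)) (m (Suc n))"
      using \<open>z \<noteq> 0\<close> by (simp_all add: vec_eq_iff right_diff_distrib)
    then show ?thesis
      using bounded_linear.sums[OF bounded_linear_cscale Suc, of z] by simp
  qed
  have "R ** (cscale z (mat 1) - A) - mat 1 = cscale z R - mat 1 - R ** A"
    by (simp add: bounded_bilinear.diff_right[OF bounded_bilinear_matrix_mult] right[symmetric])
  moreover have "(\<lambda>n. cscale (1 / z ^ (n + 1)) (m (Suc n) - m n ** A + (m n ** L - L ** m n))) sums
      (cscale z R - mat 1 - R ** A + (R ** L - L ** R))"
    unfolding linear_diff[OF linear_cscale] linear_add[OF linear_cscale] left[of _ "m _"]
      right[of _ L]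
    by (intro sums_add sums_diff shift
        bounded_linear.sums[OF bounded_bilinear.bounded_linear_left[OF bounded_bilinear_matrix_mult] R]
        bounded_linear.sums[OF bounded_bilinear.bounded_linear_right[OF bounded_bilinear_matrix_mult] R])
  ultimately show ?thesis by (simp only:)
qed

section \<open>The Weyl function of a band path\<close>

context band_path
begin

lemma norm_block11_pow_le:
  assumes "\<And>t i j. 1 \<le> i \<Longrightarrow> 1 \<le> j \<Longrightarrow> cmod (J t i j) \<le> B"
  shows "norm (block11 (imat_pow (J t) n)) \<le> 4 * sup_opnorm J ^ n"
proof (rule norm_matrix_le_entries)
  fix i j
  have "\<forall>i j. cmod (block11 (imat_pow (J t) n) $ i $ j) \<le> sup_opnorm J ^ n"
    unfolding forall_2 using cmod_imat_pow_le(2)[where J = J, OF banded assms] by simp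
  then show "cmod (block11 (imat_pow (J t) n) $ i $ j) \<le> sup_opnorm J ^ n" by blast
qed

lemma weyl_sums:
  assumes "\<And>t i j. 1 \<le> i \<Longrightarrow> 1 \<le> j \<Longrightarrow> cmod (J t i j) \<le> B" and "sup_opnorm J < cmod z"
  shows "(\<lambda>n. cscale (1 / z ^ (n + 1)) (block11 (imat_pow (J t) n))) sums weyl (J t) z"
  unfolding weyl_def
proof (rule summable_sums[OF summable_cscale(3)[OF _ assms(2)]])
  show "norm (block11 (imat_pow (J t) n)) \<le> 4 * sup_opnorm J ^ n" for n
    by (rule norm_block11_pow_le[OF assms(1)])
  show "0 \<le> sup_opnorm J"
    using cmod_imat_pow_le(1)[where J = J, OF banded assms(1), of 1 1] by simp
qed

text \<open>Comparing Laurent coefficients turns the Weyl equation into the moment equations;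
  \<open>lax_pow\<close> and \<open>lax_if_moments\<close> link these to the Lax equation.\<close>

lemma weyl_equation_iff_lax:
  assumes B: "\<And>t i j. 1 \<le> i \<Longrightarrow> 1 \<le> j \<Longrightarrow> cmod (J t i j) \<le> B"
  shows "weyl_equation J \<longleftrightarrow> (\<forall>t i j. 1 \<le> i \<longrightarrow> 1 \<le> j \<longrightarrow>
    ((\<lambda>s. J s i j) has_vector_derivative imat_comm (J t) (L t) i j) (at t))"
proof -
  define S where "S = sup_opnorm J"
  define m where "m n t = block11 (imat_pow (J t) n)" for n t
  define l where "l t = block11 (L t)" for t
  define g where "g n t = block11 (imat_comm (imat_pow (J t) n) (L t))" for n t
  have S0: "0 \<le> S"
    unfolding S_def using cmod_imat_pow_le(1)[where J = J, OF banded B, of 1 1] by simp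
  have m: "norm (m n t) \<le> 4 * S ^ n" for n t
    unfolding m_def S_def by (rule norm_block11_pow_le[OF B])
  have m1: "m 1 t = block11 (J t)" for t
    using imat_pow_1[of 1] imat_pow_1[of 2]
    by (simp add: m_def vec_eq_iff forall_2 del: One_nat_def imat_pow.simps)
  have m0: "m 0 t = mat 1" for t
    by (simp add: m_def vec_eq_iff forall_2 mat_def)
  have g_eq: "g n t = m (Suc n) t - m n t ** m 1 t + (m n t ** l t - l t ** m n t)" for n t
    unfolding g_def m1 unfolding m_def l_def by (rule block11_imat_comm_pow[OF banded])
  have l_nth: "l t $ 1 $ 1 = 0" "l t $ 1 $ 2 = 0" "l t $ 2 $ 1 = J t 2 1" "l t $ 2 $ 2 = 0" for t
    by (simp_all add: l_def strict_lower_def)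
  have l: "norm (l t) \<le> 4 * S" for t
  proof (rule norm_matrix_le_entries)
    fix i j
    have "cmod (J t 2 1) \<le> S"
      using cmod_imat_pow_le(2)[where J = J, OF banded B, where i = 2 and j = 1 and n = 1 and t = t]
      unfolding S_def by (simp add: imat_mult_one_right)
    then have "\<forall>i j. cmod (l t $ i $ j) \<le> S"
      unfolding forall_2 l_nth using S0 by simp
    then show "cmod (l t $ i $ j) \<le> S" by blast
  qed
  obtain k where k: "0 < k" "\<And>(X :: complex^2^2) (Y :: complex^2^2). norm (X ** Y) \<le> norm X * norm Y * k"
    using bounded_bilinear.pos_bounded[OF bounded_bilinear_matrix_mult] by blast
  have prod: "norm (X ** Y) \<le> x * y * k" if "norm X \<le> x" "norm Y \<le> y" for X Y :: "complex^2^2" and x y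
  proof -
    have "norm X * norm Y * k \<le> x * y * k"
      using k(1) by (intro mult_right_mono mult_mono' that) auto
    with k(2)[of X Y] show ?thesis by linarith
  qed
  \<comment> \<open>The next moment contributes \<open>4 * S\<close> and each of the three products
    \<open>16 * S * k\<close>.\<close>
  have g: "norm (g n t) \<le> (4 * S + 48 * S * k) * S ^ n" for n t
  proof -
    have "norm (g n t) \<le> norm (m (Suc n) t) + norm (m n t ** m 1 t) + (norm (m n t ** l t) + norm (l t ** m n t))"
      unfolding g_eq by (intro norm_triangle_le norm_triangle_le_diff add_mono order.refl)
    also have "\<dots> \<le> 4 * S ^ Suc n + 4 * S ^ n * (4 * S ^ 1) * k + (4 * S ^ n * (4 * S) * k + 4 * S * (4 * S ^ n) * k)"
      by (intro add_mono prod m l)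
    finally show ?thesis by (simp add: algebra_simps)
  qed
  have isCont_matrix: "isCont F t"
    if "\<And>p q. isCont (\<lambda>s. F s $ p $ q) t" for F :: "real \<Rightarrow> complex^2^2" and t
    using that unfolding isCont_def by (intro vec_tendstoI)
  have "isCont (\<lambda>s. imat_pow (J s) n i j) t" if "1 \<le> i" "1 \<le> j" for n i j t
    using pow_differentiable[OF that] by (rule differentiable_imp_continuous_within)
  then have "\<forall>p q. isCont (\<lambda>s. m n s $ p $ q) t" for n t
    unfolding forall_2 m_def by simp
  then have m_cont: "isCont (m n) t" for n t
    by (intro isCont_matrix) blast
  have "\<forall>p q. isCont (\<lambda>s. l s $ p $ q) t" for t
    unfolding forall_2 l_nth
    using differentiable[of 2 1 t] by (auto intro: differentiable_imp_continuous_within)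
  then have l_cont: "isCont l t" for t
    by (intro isCont_matrix) blast
  \<comment> \<open>Continuity supplies the antiderivatives behind
    \<open>laurent_series_derivative_iff\<close>.\<close>
  have g_cont: "isCont (g n) t" for n t
    unfolding g_eq[abs_def]
    by (intro continuous_intros bounded_bilinear.isCont[OF bounded_bilinear_matrix_mult] m_cont l_cont)
  have rhs: "(\<Sum>n. cscale (1 / z ^ (n + 1)) (g n t)) =
      weyl (J t) z ** (cscale z (mat 1) - block11 (J t)) - mat 1
      + (weyl (J t) z ** l t - l t ** weyl (J t) z)" if "S < cmod z" for z t
  proof -
    have "(\<lambda>n. cscale (1 / z ^ (n + 1)) (m n t)) sums weyl (J t) z"
      unfolding m_def by (rule weyl_sums[OF B]) (use that in \<open>auto simp: S_def\<close>)
    moreover have "z \<noteq> 0" using that S0 by auto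
    ultimately show ?thesis
      unfolding g_eq m1 by (intro sums_unique[symmetric] sums_weyl_rhs[where m = "\<lambda>n. m n t", OF _ m0])
  qed
  have "weyl_equation J \<longleftrightarrow> (\<forall>t z. S < cmod z \<longrightarrow>
      ((\<lambda>s. \<Sum>n. cscale (1 / z ^ (n + 1)) (m n s)) has_vector_derivative
        (\<Sum>n. cscale (1 / z ^ (n + 1)) (g n t))) (at t))"
    unfolding weyl_equation_def
    by (simp only: rhs S_def[symmetric] l_def[symmetric] cong: imp_cong)
      (simp only: weyl_def m_def)
  also have "\<dots> \<longleftrightarrow> (\<forall>n t. (m n has_vector_derivative g n t) (at t))"
    by (rule laurent_series_derivative_iff[OF S0 m g g_cont])
  also have "\<dots> \<longleftrightarrow> (\<forall>t i j. 1 \<le> i \<longrightarrow> 1 \<le> j \<longrightarrow>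
      ((\<lambda>s. J s i j) has_vector_derivative imat_comm (J t) (L t) i j) (at t))"
  proof (intro iffI allI impI)
    fix t i j assume "\<forall>n t. (m n has_vector_derivative g n t) (at t)" "1 \<le> (i::nat)" "1 \<le> (j::nat)"
    then show "((\<lambda>s. J s i j) has_vector_derivative imat_comm (J t) (L t) i j) (at t)"
      by (intro lax_if_moments) (auto simp: m_def[abs_def] g_def)
  next
    fix n t
    assume lax: "\<forall>t i j. 1 \<le> i \<longrightarrow> 1 \<le> j \<longrightarrow>
      ((\<lambda>s. J s i j) has_vector_derivative imat_comm (J t) (L t) i j) (at t)"
    have "\<forall>p q. ((\<lambda>s. m n s $ p $ q) has_vector_derivative g n t $ p $ q) (at t)"
      unfolding forall_2 m_def g_def using lax lax_pow[where t = t and n = n] by simp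
    then show "(m n has_vector_derivative g n t) (at t)"
      by (intro has_vector_derivative_matrix) blast
  qed
  finally show ?thesis .
qed

end

section \<open>The explicit formula\<close>

lemma matrix_inv_eq:
  assumes "A ** B = mat 1" "B ** A = mat 1"
  shows "matrix_inv A = (B :: 'a::semiring_1^'n^'n)"
proof -
  have "A ** matrix_inv A = mat 1 \<and> matrix_inv A ** A = mat 1"
    unfolding matrix_inv_def by (rule someI[where x = B]) (use assms in simp)
  then have "matrix_inv A = (B ** A) ** matrix_inv A" "B = B ** (A ** matrix_inv A)"
    using assms by simp_all
  then show ?thesis by (simp add: matrix_mul_assoc)
qed

lemma has_vector_derivative_interval_integral:
  fixes f :: "real \<Rightarrow> 'a::euclidean_space"
  assumes "\<And>t. isCont f t"
  shows "((\<lambda>t. LBINT s=0..t. f s) has_vector_derivative f t) (at t)"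
proof -
  \<comment> \<open>The compact interval contains 0 and has \<open>t\<close> in its interior, for
    either sign of \<open>t\<close>.\<close>
  define r where "r = \<bar>t\<bar> + 1"
  have "((\<lambda>u. LBINT y=ereal 0..ereal u. f y) has_vector_derivative f t) (at t within {-r..r})"
    using assms by (intro interval_integral_FTC2 continuous_at_imp_continuous_on) (auto simp: r_def)
  moreover have "at t within {-r..r} = at t"
    by (rule at_within_interior) (auto simp: r_def)
  ultimately show ?thesis by (simp add: zero_ereal_def)
qed

lemma has_vector_derivative_exp_integral:
  fixes f :: "real \<Rightarrow> complex"
  assumes "\<And>t. isCont f t"
  shows "((\<lambda>t. exp (LBINT s=0..t. f s)) has_vector_derivative exp (LBINT s=0..t. f s) * f t) (at t)"
  using field_vector_diff_chain_at[OF has_vector_derivative_interval_integral[OF assms] DERIV_exp]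
  by (simp add: o_def mult.commute)

lemma N_mat_nth:
  "N_mat a b t $ 1 $ 1 = exp (LBINT s=0..t. b 1 s)"
  "N_mat a b t $ 1 $ 2 = exp (LBINT s=0..t. b 1 s) *
     (LBINT s=0..t. a 2 s * exp (LBINT r=0..s. (b 2 r - b 1 r)))"
  "N_mat a b t $ 2 $ 1 = 0"
  "N_mat a b t $ 2 $ 2 = exp (LBINT s=0..t. b 2 s)"
  by (simp_all add: N_mat_def)

lemma M_mat_nth:
  "M_mat a t $ 1 $ 1 = 1" "M_mat a t $ 1 $ 2 = 0" "M_mat a t $ 2 $ 1 = - a 1 t" "M_mat a t $ 2 $ 2 = 1"
  by (simp_all add: M_mat_def)

text \<open>\<open>N_mat\<close> is the fundamental solution of the linear system given by the upper
  triangular part of the corner block.\<close>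

lemma N_mat_derivative:
  assumes a: "\<And>t. isCont (a 2) t" and b: "\<And>t. isCont (b 1) t" "\<And>t. isCont (b 2) t"
  shows "((\<lambda>t. N_mat a b t $ i $ j) has_vector_derivative
    ((vector [vector [b 1 t, a 2 t], vector [0, b 2 t]] :: complex^2^2) ** N_mat a b t) $ i $ j) (at t)"
proof -
  define B1 B2 E where "B1 t = (LBINT s=0..t. b 1 s)" and "B2 t = (LBINT s=0..t. b 2 s)"
    and "E s = exp (LBINT r=0..s. (b 2 r - b 1 r))" for t s :: real
  note d = has_vector_derivative_exp_integral
  have dB1: "((\<lambda>t. exp (B1 t)) has_vector_derivative exp (B1 t) * b 1 t) (at t)" for t
    unfolding B1_def by (rule d[OF b(1)])
  have dB2: "((\<lambda>t. exp (B2 t)) has_vector_derivative exp (B2 t) * b 2 t) (at t)" for t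
    unfolding B2_def by (rule d[OF b(2)])
  have dE: "(E has_vector_derivative E t * (b 2 t - b 1 t)) (at t)" for t
    unfolding E_def[abs_def] by (rule d) (intro continuous_intros b)
  have contE: "isCont E t" for t
    using dE by (rule has_vector_derivative_continuous)
  \<comment> \<open>The integral of \<open>b 2 - b 1\<close> and \<open>B2 - B1\<close> have the
    same derivative and agree at 0.\<close>
  have E_eq: "exp (B1 t) * E t = exp (B2 t)" for t
  proof -
    have int: "((\<lambda>t. (LBINT r=0..t. (b 2 r - b 1 r)) - (B2 t - B1 t)) has_vector_derivative
        (b 2 t - b 1 t) - (b 2 t - b 1 t)) (at t)" for t
      unfolding B1_def B2_def
      by (intro has_vector_derivative_diff has_vector_derivative_interval_integral continuous_intros b)
    obtain c where c: "\<And>t. (LBINT r=0..t. (b 2 r - b 1 r)) - (B2 t - B1 t) = c"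
      by (rule has_vector_derivative_zero_constant[of UNIV
            "\<lambda>t. (LBINT r=0..t. (b 2 r - b 1 r)) - (B2 t - B1 t)"]) (use int in auto)
    have "c = 0"
      using c[of 0] by (simp add: B1_def B2_def zero_ereal_def[symmetric])
    then have "E t = exp (B2 t - B1 t)"
      using c[of t] by (simp add: E_def)
    then show ?thesis by (simp add: exp_diff)
  qed
  have dF: "((\<lambda>t. LBINT s=0..t. a 2 s * E s) has_vector_derivative a 2 t * E t) (at t)" for t
    by (intro has_vector_derivative_interval_integral continuous_intros a contE)
  have d12: "((\<lambda>t. exp (B1 t) * (LBINT s=0..t. a 2 s * E s)) has_vector_derivative
      b 1 t * (exp (B1 t) * (LBINT s=0..t. a 2 s * E s)) + a 2 t * exp (B2 t)) (at t)"
    using has_vector_derivative_mult[OF dB1 dF, of t] by (simp add: E_eq[symmetric] algebra_simps)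
  have "\<forall>i j. ((\<lambda>t. N_mat a b t $ i $ j) has_vector_derivative
    ((vector [vector [b 1 t, a 2 t], vector [0, b 2 t]] :: complex^2^2) ** N_mat a b t) $ i $ j) (at t)"
    unfolding forall_2 N_mat_nth matrix_matrix_mult_def sum_2
    using dB1[of t] dB2[of t] d12
    by (simp add: N_mat_nth B1_def B2_def E_def[abs_def] mult.commute)
  then show ?thesis by blast
qed

lemma bounded_bilinear_cscale: "bounded_bilinear cscale"
  by (rule bounded_bilinear.intro) (auto simp: vec_eq_iff algebra_simps norm_cscale intro!: exI[of _ 1])

lemma matrix_inv_M_mat:
  "M_mat a t ** matrix_inv (M_mat a t) = mat 1"
  "matrix_inv (M_mat a t) = vector [vector [1, 0], vector [a 1 t, 1]]"
proof -
  let ?B = "vector [vector [1, 0], vector [a 1 t, 1]] :: complex^2^2"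
  have *: "M_mat a t ** ?B = mat 1" "?B ** M_mat a t = mat 1"
    by (simp_all add: vec_eq_iff forall_2 matrix_matrix_mult_def sum_2 M_mat_nth mat_def)
  from matrix_inv_eq[OF this] show "matrix_inv (M_mat a t) = ?B" .
  with * show "M_mat a t ** matrix_inv (M_mat a t) = mat 1" by simp
qed

lemma matrix_inv_N_mat: "N_mat a b t ** matrix_inv (N_mat a b t) = mat 1"
proof -
  let ?N = "N_mat a b t"
  let ?B = "vector [vector [1 / ?N $ 1 $ 1, - ?N $ 1 $ 2 / (?N $ 1 $ 1 * ?N $ 2 $ 2)],
      vector [0, 1 / ?N $ 2 $ 2]] :: complex^2^2"
  have nz: "?N $ 1 $ 1 \<noteq> 0" "?N $ 2 $ 2 \<noteq> 0" "?N $ 2 $ 1 = 0"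
    by (simp_all add: N_mat_nth)
  have *: "?N ** ?B = mat 1" "?B ** ?N = mat 1"
    using nz by (simp_all add: vec_eq_iff forall_2 matrix_matrix_mult_def sum_2 mat_def)
  from matrix_inv_eq[OF this] * show ?thesis by simp
qed

lemma N_mat_0: "N_mat a b 0 = mat 1"
  by (simp add: vec_eq_iff forall_2 N_mat_nth mat_def zero_ereal_def[symmetric])

lemma weyl_explicit_formula:
  fixes a b c d :: "nat \<Rightarrow> real \<Rightarrow> complex"
  defines "J \<equiv> band_matrix a b c d"
  assumes a1: "\<And>t. (a 1 has_vector_derivative c 1 t) (at t)"
    and cont: "\<And>t. isCont (a 2) t" "\<And>t. isCont (b 1) t" "\<And>t. isCont (b 2) t"
    and weyl: "\<And>t. ((\<lambda>s. weyl (J s) z) has_vector_derivative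
      (weyl (J t) z ** (cscale z (mat 1) - block11 (J t)) - mat 1
       + (weyl (J t) z ** block11 (strict_lower (J t))
          - block11 (strict_lower (J t)) ** weyl (J t) z))) (at t)"
  shows "weyl (J t) z =
    cscale (exp (z * of_real t)) (M_mat a t ** T_mat a b J t z ** matrix_inv (N_mat a b t))"
proof -
  define R where "R s = weyl (J s) z" for s
  \<comment> \<open>\<open>M'\<close> is the inverse of \<open>M_mat\<close>, not a
    derivative.\<close>
  define M' where "M' s = (vector [vector [1, 0], vector [a 1 s, 1]] :: complex^2^2)" for s
  define N where "N s = N_mat a b s" for s
  define e where "e s = exp (- z * complex_of_real s)" for s
  define l where "l s = (vector [vector [0, 0], vector [c 1 s, 0]] :: complex^2^2)" for s
  define u where "u s = (vector [vector [b 1 s, a 2 s], vector [0, b 2 s]] :: complex^2^2)" for s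
  define Q where "Q s = cscale (e s) (M' s ** (R s ** N s))" for s
  have l: "block11 (strict_lower (J s)) = l s" for s
    by (simp add: vec_eq_iff forall_2 l_def J_def band_matrix_def strict_lower_def)
  have u: "block11 (J s) = l s + u s" for s
    by (simp add: vec_eq_iff forall_2 l_def u_def J_def band_matrix_def numeral_2_eq_2)
  have dR: "(R has_vector_derivative
      R s ** (cscale z (mat 1) - (l s + u s)) - mat 1 + (R s ** l s - l s ** R s)) (at s)" for s
    using weyl[of s] unfolding l u R_def .
  have dN: "(N has_vector_derivative u s ** N s) (at s)" for s
    unfolding N_def[abs_def] u_def by (intro has_vector_derivative_matrix N_mat_derivative cont)
  have "\<forall>p q. ((\<lambda>s. M' s $ p $ q) has_vector_derivative l s $ p $ q) (at s)" for s
    unfolding forall_2 M'_def l_def using a1[of s] by simp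
  then have dM: "(M' has_vector_derivative l s) (at s)" for s
    by (intro has_vector_derivative_matrix) blast
  have de: "(e has_vector_derivative - z * e s) (at s)" for s
    unfolding e_def[abs_def]
    by (auto intro!: derivative_eq_intros has_vector_derivative_real_field)
  \<comment> \<open>\<^term>\<open>M'\<close>, \<^term>\<open>N\<close> and \<^term>\<open>e\<close> are integrating factors for the linear equation of \<^term>\<open>R\<close>.\<close>
  have "(Q has_vector_derivative - cscale (e s) (M' s ** N s)) (at s)" for s
  proof -
    note dprod = bounded_bilinear.has_vector_derivative[OF bounded_bilinear_matrix_mult]
    have "(Q has_vector_derivative
        cscale (e s) (M' s ** (R s ** (u s ** N s) +
            (R s ** (cscale z (mat 1) - (l s + u s)) - mat 1 + (R s ** l s - l s ** R s)) ** N s)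
          + l s ** (R s ** N s))
        + cscale (- z * e s) (M' s ** (R s ** N s))) (at s)"
      unfolding Q_def[abs_def]
      by (intro bounded_bilinear.has_vector_derivative[OF bounded_bilinear_cscale] de dprod dM dR dN)
    \<comment> \<open>The terms \<open>R l\<close> cancel. The remaining \<open>z R\<close>,
      \<open>- R u\<close> and \<open>- l R\<close> are offset by the derivatives of
      \<open>e\<close>, \<open>N\<close> and \<open>M'\<close>, the last because
      \<open>M' s ** l s = l s\<close>; only the term from \<open>- mat 1\<close> survives.\<close>
    also have "cscale (e s) (M' s ** (R s ** (u s ** N s) +
            (R s ** (cscale z (mat 1) - (l s + u s)) - mat 1 + (R s ** l s - l s ** R s)) ** N s)
          + l s ** (R s ** N s))
        + cscale (- z * e s) (M' s ** (R s ** N s)) = - cscale (e s) (M' s ** N s)"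
      unfolding vec_eq_iff forall_2
      by (simp add: matrix_matrix_mult_def sum_2 M'_def l_def mat_def algebra_simps)
    finally show ?thesis .
  qed
  then have "((\<lambda>s. - Q s) has_vector_derivative cscale (e s) (M' s ** N s)) (at s within A)" for s A
    using has_vector_derivative_minus has_vector_derivative_at_within by fastforce
  moreover have "isCont (\<lambda>s. cscale (e s) (M' s ** N s)) s" for s
    by (intro bounded_bilinear.isCont[OF bounded_bilinear_cscale]
        bounded_bilinear.isCont[OF bounded_bilinear_matrix_mult]
        has_vector_derivative_continuous[OF de] has_vector_derivative_continuous[OF dM]
        has_vector_derivative_continuous[OF dN])
  ultimately have "(LBINT s=ereal 0..ereal t. cscale (e s) (M' s ** N s)) = - Q t - - Q 0"
    by (intro interval_integral_FTC_finite continuous_at_imp_continuous_on) auto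
  \<comment> \<open>The constant term in \<open>T_mat\<close> is exactly \<open>Q 0\<close>, as
    \<open>e\<close> and \<open>N\<close> are trivial at 0.\<close>
  then have "T_mat a b J t z = Q t - Q 0 + M' 0 ** R 0"
    by (simp add: T_mat_def matrix_inv_M_mat(2) e_def M'_def N_def R_def zero_ereal_def)
  also have "Q 0 = M' 0 ** R 0"
    by (simp add: Q_def e_def N_def N_mat_0 vec_eq_iff)
  finally have T: "T_mat a b J t z = cscale (e t) (M' t ** (R t ** N t))"
    by (simp add: Q_def)
  have scale: "cscale w (X ** Y) = X ** cscale w Y" "cscale w (X ** Y) = cscale w X ** Y" for w X Y
    by (simp_all add: vec_eq_iff matrix_matrix_mult_def sum_2 algebra_simps)
  have "M_mat a t ** T_mat a b J t z ** matrix_inv (N_mat a b t) =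
      cscale (e t) (M_mat a t ** matrix_inv (M_mat a t) ** R t ** (N t ** matrix_inv (N t)))"
    unfolding T scale(1)[symmetric] scale(2)[symmetric] matrix_inv_M_mat(2) M'_def[symmetric]
    by (simp add: matrix_mul_assoc N_def)
  also have "\<dots> = cscale (e t) (R t)"
    by (simp add: matrix_inv_M_mat(1) N_def matrix_inv_N_mat)
  finally show ?thesis
    by (simp add: e_def R_def vec_eq_iff exp_minus)
qed

text \<open>\<open>J\<close> does not contain \<open>a 1\<close>, so the Weyl equation characterizes
  the system on the matrix entries; the full system adds the equation for \<open>a 1\<close>, which
  the explicit formula uses to differentiate the inverse of \<open>M_mat\<close>.\<close>

theorem theorem5:
  fixes a b c d :: "nat \<Rightarrow> real \<Rightarrow> complex" and K :: real and J :: "real \<Rightarrow> imat"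
  assumes diff: "\<And>n t. n \<ge> 1 \<Longrightarrow>
      a n differentiable (at t) \<and> b n differentiable (at t) \<and>
      c n differentiable (at t) \<and> d n differentiable (at t)"
    and a1_real: "\<And>t. a 1 t \<in> \<real>"
    and zero: "\<And>t. a 0 t = 0 \<and> b 0 t = 0 \<and> c 0 t = 0 \<and> d 0 t = 0"
    and d_nz: "\<And>n t. n \<ge> 1 \<Longrightarrow> d n t \<noteq> 0"
    and J: "J = band_matrix a b c d"
    and bounded: "K > 0"
      "\<And>n t. n \<ge> 1 \<Longrightarrow>
        Max {cmod (a n t), cmod (b n t), cmod (c n t), cmod (d n t)} \<le> K"
  shows "(lattice_solution_entries a b c d \<longleftrightarrow> weyl_equation J) \<and>
    (lattice_solution a b c d \<longleftrightarrow>
       (\<forall>t. (a 1 has_vector_derivative c 1 t) (at t)) \<and> weyl_equation J) \<and>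
    (lattice_solution a b c d \<longrightarrow>
      (\<forall>t z. cmod z > sup_opnorm J \<longrightarrow>
        weyl (J t) z =
          cscale (exp (z * of_real t)) (M_mat a t ** T_mat a b J t z ** matrix_inv (N_mat a b t))))"
proof -
  interpret band_path J
    unfolding J by (rule band_path_band_matrix[OF diff d_nz])
  \<comment> \<open>The 1 in the maximum covers the constant diagonal of ones.\<close>
  have B: "cmod (J t i j) \<le> max 1 K" if "1 \<le> i" "1 \<le> j" for t i j
  proof -
    have K: "cmod (a n t) \<le> K" "cmod (b n t) \<le> K" "cmod (c n t) \<le> K" "cmod (d n t) \<le> K"
      if "1 \<le> n" for n
      using bounded(2)[OF that, of t] by simp_all
    show ?thesis
      unfolding J band_matrix_def using K[OF that(1)] K[OF that(2)] K[of "i + 1"]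
      by (auto simp: le_max_iff_disj)
  qed
  have entries: "lattice_solution_entries a b c d \<longleftrightarrow> weyl_equation J"
    using weyl_equation_iff_lax[OF B] lattice_solution_entries_iff_lax[of c d a b] zero
    by (simp add: J)
  have solution: "lattice_solution a b c d \<longleftrightarrow>
      (\<forall>t. (a 1 has_vector_derivative c 1 t) (at t)) \<and> lattice_solution_entries a b c d"
  proof
    assume sol: "lattice_solution a b c d"
    \<comment> \<open>Here \<open>1 - 2\<close> is 0 on natural numbers, and \<open>c 0\<close>
      vanishes.\<close>
    then have "(a 1 has_vector_derivative c 1 t - c (1 - 2) t) (at t)" for t
      unfolding lattice_solution_def by blast
    with sol show "(\<forall>t. (a 1 has_vector_derivative c 1 t) (at t)) \<and> lattice_solution_entries a b c d"
      using zero by (simp add: lattice_solution_def lattice_solution_entries_def)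
  next
    assume sol: "(\<forall>t. (a 1 has_vector_derivative c 1 t) (at t)) \<and> lattice_solution_entries a b c d"
    have "(a n has_vector_derivative (c n t - c (n - 2) t)) (at t)" if "1 \<le> n" for n t
      using sol that zero by (cases "n = 1") (auto simp: lattice_solution_entries_def)
    with sol show "lattice_solution a b c d"
      by (simp add: lattice_solution_def lattice_solution_entries_def)
  qed
  have "isCont (a n) t" "isCont (b n) t" if "1 \<le> n" for n t
    using diff[OF that] differentiable_imp_continuous_within by blast+
  then have "weyl (J t) z =
      cscale (exp (z * of_real t)) (M_mat a t ** T_mat a b J t z ** matrix_inv (N_mat a b t))"
    if "lattice_solution a b c d" "sup_opnorm J < cmod z" for t z
    using that entries solution unfolding weyl_equation_def J
    by (intro weyl_explicit_formula) auto
  with entries solution show ?thesis by blast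
qed

end
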